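(* Let $K$ be a centrally symmetric convex body in $\mathbb{R}^d$. Every pairwise intersecting Minkowski arrangement consisting of translates of $K$ contains at most $3^d$ elements. This bound is sharp: there is a pairwise intersecting Minkowski arrangement consisting of exactly $3^d$ translates of $K$ if and only if $K$ is a $d$-dimensional parallelotope.
   Context: A convex body is a compact convex set with non-empty interior. A family of positive homothetic copies (in particular, translates) of a centrally symmetric convex body is a pairwise intersecting Minkowski arrangement if any two members intersect and no member contains the center of symmetry of any other member in its interior. *)

theory Defs
  imports "HOL-Analysis.Analysis"
begin

definition convex_body :: "'a::euclidean_space set \<Rightarrow> bool" where
  "convex_body K \<longleftrightarrow> compact K \<and> convex K \<and> interior K \<noteq> {}"

definition center_of_symmetry :: "'a::euclidean_space \<Rightarrow> 'a set \<Rightarrow> bool" where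
  "center_of_symmetry c K \<longleftrightarrow> (\<lambda>x. 2 *\<^sub>R c - x) ` K = K"

definition centrally_symmetric :: "'a::euclidean_space set \<Rightarrow> bool" where
  "centrally_symmetric K \<longleftrightarrow> (\<exists>c. center_of_symmetry c K)"

text \<open>Quantifying over centers of symmetry below is unambiguous, since a nonempty bounded set
  has at most one.\<close>

lemma center_of_symmetry_unique:
  fixes K :: "'a::euclidean_space set"
  assumes "bounded K" "K \<noteq> {}" and c: "center_of_symmetry c K" and c': "center_of_symmetry c' K"
  shows "c = c'"
proof (rule ccontr)
  assume "c \<noteq> c'"
  define w where "w = 2 *\<^sub>R (c' - c)"
  have "w \<noteq> 0" using \<open>c \<noteq> c'\<close> by (simp add: w_def)
  have shift: "x + w \<in> K" if "x \<in> K" for x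
  proof -
    have "2 *\<^sub>R c - x \<in> K" using c that unfolding center_of_symmetry_def by blast
    then have "2 *\<^sub>R c' - (2 *\<^sub>R c - x) \<in> K" using c' unfolding center_of_symmetry_def by blast
    then show ?thesis by (simp add: w_def algebra_simps)
  qed
  obtain x where "x \<in> K" using assms(2) by blast
  have iter: "x + real n *\<^sub>R w \<in> K" for n
  proof (induction n)
    case (Suc n)
    then show ?case using shift[OF Suc] by (simp add: algebra_simps)
  qed (simp add: \<open>x \<in> K\<close>)
  obtain M where M: "\<And>y. y \<in> K \<Longrightarrow> norm y \<le> M" using assms(1) bounded_iff by blast
  obtain n where n: "real n * norm w > M + norm x"
    using reals_Archimedean3[of "norm w"] \<open>w \<noteq> 0\<close> by auto
  have "norm (real n *\<^sub>R w) \<le> norm (x + real n *\<^sub>R w) + norm x"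
    using norm_triangle_ineq4[of "x + real n *\<^sub>R w" x] by simp
  with M[OF iter[of n]] n show False by simp
qed

definition positive_homothetic_copy :: "'a::euclidean_space set \<Rightarrow> 'a set \<Rightarrow> bool" where
  "positive_homothetic_copy K A \<longleftrightarrow> (\<exists>r>0. \<exists>v. A = (\<lambda>x. v + r *\<^sub>R x) ` K)"

definition translate_of :: "'a::euclidean_space set \<Rightarrow> 'a set \<Rightarrow> bool" where
  "translate_of K A \<longleftrightarrow> (\<exists>v. A = (\<lambda>x. v + x) ` K)"

text \<open>Families are sets of bodies: a repeated member would contain the center of its copy in
  its interior, so indexed families give nothing more.\<close>

definition pairwise_intersecting_Minkowski_arrangement ::
    "'a::euclidean_space set \<Rightarrow> 'a set set \<Rightarrow> bool" where
  "pairwise_intersecting_Minkowski_arrangement K F \<longleftrightarrow>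
     (\<forall>A\<in>F. positive_homothetic_copy K A) \<and>
     pairwise (\<lambda>A B. A \<inter> B \<noteq> {}) F \<and>
     pairwise (\<lambda>A B. \<forall>c. center_of_symmetry c A \<longrightarrow> c \<notin> interior B) F"

definition parallelotope :: "nat \<Rightarrow> 'a::euclidean_space set \<Rightarrow> bool" where
  "parallelotope k P \<longleftrightarrow>
     (\<exists>a B. independent B \<and> card B = k \<and>
        P = {a + (\<Sum>b\<in>B. t b *\<^sub>R b) | t. \<forall>b\<in>B. 0 \<le> t b \<and> t b \<le> 1})"

end

theory Submission
  imports Defs
begin

text \<open>Move \<open>K\<close> so that its center is the origin and call the result \<open>L\<close>. An arrangement of
translates is a set \<open>V\<close> of vectors, any two of which have a difference in \<open>2 L\<close> but not in the
interior of \<open>L\<close> (\<open>translate_arrangement_iff_spread\<close>).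

For the bound, choose a full-dimensional convex body \<open>Q\<close> that contains \<open>V\<close> and satisfies
\<open>Q - Q \<subseteq> 2 L\<close> (\<open>full_dimensional_hull\<close>). The bodies \<open>2 x + Q\<close> with \<open>x \<in> V\<close> are
contained in \<open>3 Q\<close> by convexity, and their interiors are disjoint because \<open>x - y\<close> is not
interior to \<open>L\<close>. Comparing volumes yields \<open>3 ^ d\<close>, where \<open>d\<close> is the dimension
(\<open>tripled_body_packing\<close>). This is in the spirit of the volume argument of Danzer and
Gruenbaum for antipodal sets.

If \<open>V\<close> has \<open>3 ^ d\<close> elements, these bodies tile \<open>3 Q\<close>. Every extreme point of \<open>Q\<close> then
belongs to \<open>V\<close>, and \<open>Q\<close> is a polytope. Let \<open>[v, w]\<close> be one of its edges. The tripled edge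
can only be covered by tiles whose translation vectors lie on the edge, and near its point
\<open>2 v + w\<close> just two tiles are present: one looks like \<open>Q\<close> near \<open>w\<close>, the other like \<open>Q\<close>
near \<open>v\<close>, and a hyperplane separates them. Since \<open>3 Q\<close> is locally invariant along the edge,
the cone of \<open>Q\<close> at \<open>v\<close> is the direct sum of the ray along the edge and a cone in the hyperplane,
and the cone at \<open>w\<close> differs from it only by reversing the ray
(\<open>edge_splits_feasible_cones\<close>). A cone from which every extreme ray splits off is simplicial,
so the edges at a vertex form a basis (\<open>edges_at_vertex_form_basis\<close>), and \<open>Q\<close> lies in the box
that they span. Walking along edges, and reversing one ray of the cone at each step, reaches all
corners of this box (\<open>corners_of_box\<close>), so \<open>Q\<close> is the box.

Finally \<open>L\<close> contains the centered box \<open>(Q - Q) / 2\<close>. A point of \<open>L\<close> outside this box would make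
half of some edge vector interior to \<open>L\<close>, although it is a difference of two elements of \<open>V\<close>,
an end point and the midpoint of the edge (\<open>extremal_spread_set_box\<close>). Conversely, a box
carries the grid of \<open>3 ^ d\<close> points with coordinates \<open>-1/2\<close>, \<open>0\<close> and \<open>1/2\<close>
(\<open>box_has_extremal_spread_set\<close>).\<close>

section \<open>Difference bodies\<close>

definition difference_body :: "'a::euclidean_space set \<Rightarrow> 'a set" where
  "difference_body P = {p - q | p q. p \<in> P \<and> q \<in> P}"

lemma difference_bodyI: "p \<in> P \<Longrightarrow> q \<in> P \<Longrightarrow> p - q \<in> difference_body P"
  unfolding difference_body_def by blast

lemma convex_difference_body:
  assumes "convex P"
  shows "convex (difference_body P)"
proof -
  have "difference_body P = (\<Union>x\<in>P. \<Union>y\<in>P. {x - y})"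
    unfolding difference_body_def by auto
  then show ?thesis using convex_differences[OF assms assms] by simp
qed

lemma difference_of_interior:
  assumes "p \<in> interior P" "q \<in> P"
  shows "p - q \<in> interior (difference_body P)"
proof -
  have "(\<lambda>x. x - q) ` interior P \<subseteq> difference_body P"
    using assms interior_subset[of P] by (auto intro!: difference_bodyI)
  moreover have "open ((\<lambda>x. x - q) ` interior P)"
    by (simp add: open_translation_subtract)
  ultimately show ?thesis using assms interiorI by blast
qed

lemma zero_in_interior_difference_body:
  "interior P \<noteq> {} \<Longrightarrow> 0 \<in> interior (difference_body P)"
  using difference_of_interior[of _ P] interior_subset[of P] by fastforce

section \<open>A full-dimensional hull and the volume bound\<close>

lemma difference_of_convex_hulls:
  assumes "convex L" and sub: "\<And>x y. x \<in> S \<Longrightarrow> y \<in> T \<Longrightarrow> x - y \<in> L"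
    and "p \<in> convex hull S" "q \<in> convex hull T"
  shows "p - q \<in> L"
proof -
  have 1: "p - y \<in> L" if "y \<in> T" for y
  proof -
    have "S \<subseteq> (\<lambda>z. y + z) ` L" using sub[OF _ that] by (force simp: image_iff)
    moreover have "convex ((\<lambda>z. y + z) ` L)" using assms(1) by (rule convex_translation)
    ultimately have "p \<in> (\<lambda>z. y + z) ` L" using assms(3) hull_minimal by blast
    then show ?thesis by auto
  qed
  have "T \<subseteq> (\<lambda>z. p - z) ` L" using 1 by (force simp: image_iff)
  moreover have "convex ((\<lambda>z. p - z) ` L)"
    using assms(1) convex_translation[OF convex_negations[OF assms(1)], of p]
    by (simp add: image_image)
  ultimately have "q \<in> (\<lambda>z. p - z) ` L" using assms(4) hull_minimal by blast
  then show ?thesis by auto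
qed

text \<open>The convex hull of \<open>X\<close> may be flat. Averaging \<open>y - x\<close> over \<open>y \<in> X\<close> includes the
difference \<open>0\<close>, an interior point of \<open>L\<close>, so the average is an interior point as well. Hence a
small ball around the centroid of \<open>X\<close> can be added to \<open>X\<close> without its differences leaving
\<open>L\<close>, and this makes the hull full-dimensional.\<close>

lemma full_dimensional_hull:
  fixes X :: "'a::euclidean_space set"
  assumes "finite X" "X \<noteq> {}" and L: "convex L" "0 \<in> interior L" "\<And>z. z \<in> L \<Longrightarrow> - z \<in> L"
    and diff: "\<And>x y. x \<in> X \<Longrightarrow> y \<in> X \<Longrightarrow> x - y \<in> L"
  obtains Q where "X \<subseteq> Q" "compact Q" "convex Q" "interior Q \<noteq> {}" "difference_body Q \<subseteq> L"
proof -
  define n where "n = card X"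
  have n: "n \<noteq> 0" using assms n_def by auto
  obtain e where e: "e > 0" "ball 0 e \<subseteq> L"
    using L(2) mem_interior by blast
  define m where "m = (1 / n) *\<^sub>R (\<Sum>x\<in>X. x)"
  define r where "r = e / (4 * n)"
  have r: "r > 0" using e n by (simp add: r_def)
  have near: "m + z - x \<in> L" if "x \<in> X" "norm z \<le> r" for x z
  proof -
    \<comment> \<open>The whole perturbation is charged to the zero difference \<open>x - x\<close>, whose weight in the
      average is \<open>1 / n\<close>; this is why the radius is of order \<open>e / n\<close>.\<close>
    define g where "g y = (y - x) + (if y = x then real n *\<^sub>R z else 0)" for y
    have "norm (real n *\<^sub>R z) < e"
    proof -
      have "norm (real n *\<^sub>R z) \<le> n * r" using that by (simp add: mult_left_mono)
      also have "\<dots> < e" using e n by (simp add: r_def)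
      finally show ?thesis .
    qed
    then have "real n *\<^sub>R z \<in> L" using e(2) by auto
    then have "g y \<in> L" if "y \<in> X" for y
      using diff[OF that \<open>x \<in> X\<close>] by (simp add: g_def)
    then have "(\<Sum>y\<in>X. (1 / n) *\<^sub>R g y) \<in> L"
      using assms(1) L(1) n by (intro convex_sum) (auto simp: n_def)
    also have "(\<Sum>y\<in>X. (1 / n) *\<^sub>R g y) = (1 / n) *\<^sub>R (\<Sum>y\<in>X. g y)"
      by (simp add: scaleR_sum_right)
    also have "(\<Sum>y\<in>X. g y) = (\<Sum>y\<in>X. y) - real n *\<^sub>R x + real n *\<^sub>R z"
      using assms(1) \<open>x \<in> X\<close>
      by (simp add: g_def sum.distrib sum_subtractf n_def sum_constant_scaleR)
    also have "(1 / n) *\<^sub>R \<dots> = m + z - x"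
      using n by (simp add: m_def algebra_simps)
    finally show ?thesis .
  qed
  define G where "G = X \<union> cball m r"
  have cbd: "p - x \<in> L" if "x \<in> X" "p \<in> cball m r" for p x
    using near[OF that(1), of "p - m"] that(2) by (simp add: dist_norm norm_minus_commute)
  have cbd': "p - q \<in> L" if "p \<in> cball m r" "q \<in> cball m r" for p q
  proof -
    have "dist p q \<le> 2 * r" using that dist_triangle[of p q m] by (simp add: dist_commute)
    also have "\<dots> < e" using e n by (simp add: r_def field_simps)
    finally show ?thesis using e(2) by (auto simp: dist_norm)
  qed
  have G: "x - y \<in> L" if "x \<in> G" "y \<in> G" for x y
    using that diff cbd cbd' L(3)[OF cbd[of x y]] by (auto simp: G_def)
  show ?thesis
  proof
    show "X \<subseteq> convex hull G" using hull_subset[of G] by (auto simp: G_def)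
    show "compact (convex hull G)"
      unfolding G_def using assms(1)
      by (intro compact_convex_hull compact_Un finite_imp_compact compact_cball)
    show "convex (convex hull G)" by simp
    have "ball m r \<subseteq> G" by (auto simp: G_def)
    then have "ball m r \<subseteq> convex hull G" using hull_subset[of G convex] by blast
    then show "interior (convex hull G) \<noteq> {}" using r
      by (metis centre_in_ball emptyE interior_maximal open_ball subsetD)
    show "difference_body (convex hull G) \<subseteq> L"
      using difference_of_convex_hulls[OF L(1) G] by (auto simp: difference_body_def)
  qed
qed

text \<open>The translates \<open>2 x + Q\<close> with \<open>x \<in> X\<close> lie in \<open>3 Q\<close> by convexity, and a common interior
point of two of them would put \<open>2 (x - y)\<close> into the interior of \<open>Q - Q\<close>. Comparing volumes
gives the bound. If the bound is attained, the tiles leave a set of volume zero uncovered; its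
interior is then empty, and since the union of the tiles is closed they cover \<open>3 Q\<close>.\<close>

lemma tripled_body_packing:
  fixes Q :: "'a::euclidean_space set"
  assumes Q: "compact Q" "convex Q" "interior Q \<noteq> {}" and X: "finite X" "X \<subseteq> Q"
    and packed: "\<And>x y. x \<in> X \<Longrightarrow> y \<in> X \<Longrightarrow> x \<noteq> y \<Longrightarrow> 2 *\<^sub>R (x - y) \<notin> interior (difference_body Q)"
  shows "card X \<le> 3 ^ DIM('a)"
    and "card X = 3 ^ DIM('a) \<Longrightarrow> y \<in> Q \<Longrightarrow> \<exists>x\<in>X. \<exists>p\<in>Q. 3 *\<^sub>R y = 2 *\<^sub>R x + p"
proof -
  define V where "V = measure lebesgue Q"
  define B where "B = (\<lambda>x. 3 *\<^sub>R x) ` Q"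
  define I where "I x = (+) (2 *\<^sub>R x) ` interior Q" for x
  define T where "T x = (+) (2 *\<^sub>R x) ` Q" for x
  have bdd: "bounded Q" using Q(1) compact_imp_bounded by blast
  have mI: "measure lebesgue (interior Q) = V"
    unfolding V_def using bdd Q(2) by (intro measure_interior negligible_convex_frontier)
  have V: "V > 0"
  proof -
    have "measure lebesgue (interior Q) \<noteq> 0"
      using Q(3) bdd by (metis lmeasurable_interior negligible_iff_measure open_interior open_not_negligible)
    then show ?thesis using mI measure_nonneg[of lebesgue "interior Q"] by linarith
  qed
  have cB: "compact B" "convex B" using Q by (auto simp: B_def compact_scaling convex_scaling)
  have mB: "measure lebesgue B = 3 ^ DIM('a) * V"
    using measure_lebesgue_affine[of 3 0 Q] by (simp add: B_def V_def)
  have TB: "T x \<subseteq> B" if "x \<in> X" for x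
  proof
    fix z assume "z \<in> T x"
    then obtain p where p: "p \<in> Q" "z = 2 *\<^sub>R x + p" by (auto simp: T_def)
    have "(2/3) *\<^sub>R x + (1/3) *\<^sub>R p \<in> Q"
      using Q(2) p(1) that X by (intro convexD) auto
    moreover have "z = 3 *\<^sub>R ((2/3) *\<^sub>R x + (1/3) *\<^sub>R p)"
      using p by (simp add: scaleR_add_right)
    ultimately show "z \<in> B" by (auto simp: B_def)
  qed
  have IT: "I x \<subseteq> T x" for x unfolding I_def T_def using interior_subset by blast
  have disj: "I x \<inter> T y = {}" if "x \<in> X" "y \<in> X" "x \<noteq> y" for x y
  proof (rule ccontr)
    assume "I x \<inter> T y \<noteq> {}"
    then obtain p q where pq: "p \<in> interior Q" "q \<in> Q" "2 *\<^sub>R x + p = 2 *\<^sub>R y + q"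
      by (auto simp: I_def T_def)
    have "2 *\<^sub>R (y - x) = p - q" using pq(3) by (simp add: algebra_simps)
    then show False using difference_of_interior[OF pq(1,2)] packed[of y x] that by auto
  qed
  have Iopen: "open (I x)" for x unfolding I_def by (simp add: open_translation)
  have Imeas: "I x \<in> lmeasurable" for x
    unfolding I_def using bdd by (intro measurable_translation lmeasurable_interior)
  have "measure lebesgue (\<Union>(I ` X)) = (\<Sum>x\<in>X. measure lebesgue (I x))"
    using X(1) Imeas
  proof (rule measure_negligible_finite_Union_image)
    show "pairwise (\<lambda>x y. negligible (I x \<inter> I y)) X"
      using disj IT by (fastforce simp: pairwise_def intro!: empty_imp_negligible)
  qed
  also have "\<dots> = card X * V" by (simp add: I_def measure_translation mI)
  finally have mU: "measure lebesgue (\<Union>(I ` X)) = card X * V" .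
  have Ulm: "\<Union>(I ` X) \<in> lmeasurable" using X(1) Imeas by (intro fmeasurable.finite_Union) auto
  have UB: "\<Union>(I ` X) \<subseteq> B" using TB IT by blast
  have Blm: "B \<in> lmeasurable" using cB by (simp add: lmeasurable_compact)
  have "card X * V \<le> 3 ^ DIM('a) * V"
    using measure_mono_fmeasurable[OF UB _ Blm] Ulm mU mB by auto
  then have "real (card X) \<le> real (3 ^ DIM('a))" using V by simp
  then show "card X \<le> 3 ^ DIM('a)" by (simp only: of_nat_le_iff)
  assume eq: "card X = 3 ^ DIM('a)" and y: "y \<in> Q"
  define W where "W = interior B - \<Union>(T ` X)"
  have clT: "closed (\<Union>(T ` X))"
    using X(1) Q(1) by (auto simp: T_def intro!: closed_Union compact_imp_closed compact_translation)
  then have Wop: "open W" by (auto simp: W_def)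
  have bB: "bounded B" using cB compact_imp_bounded by blast
  then have Wlm: "W \<in> lmeasurable" using Wop
    by (intro lmeasurable_open) (auto intro!: bounded_subset[OF bB] simp: W_def dest: interior_subset[THEN subsetD])
  have Wdis: "W \<inter> \<Union>(I ` X) = {}" using IT by (auto simp: W_def)
  have "measure lebesgue (W \<union> \<Union>(I ` X)) = measure lebesgue W + measure lebesgue (\<Union>(I ` X))"
    using Wlm Ulm Wdis by (simp add: measure_Un3)
  moreover have "measure lebesgue (W \<union> \<Union>(I ` X)) \<le> measure lebesgue B"
    using UB Wlm Ulm Blm interior_subset[of B] by (intro measure_mono_fmeasurable) (auto simp: W_def)
  ultimately have "measure lebesgue W \<le> 0" using mU mB eq by simp
  then have "negligible W" using Wlm measure_nonneg[of lebesgue W] by (simp add: negligible_iff_measure)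
  then have "W = {}" using Wop open_not_negligible by blast
  then have "interior B \<subseteq> \<Union>(T ` X)" by (auto simp: W_def)
  then have "closure (interior B) \<subseteq> \<Union>(T ` X)" using clT closure_minimal by blast
  moreover have "interior B \<noteq> {}"
  proof -
    have "V * 3 ^ DIM('a) \<noteq> 0" using V by simp
    then show ?thesis
      using mB cB by (metis bB measure_interior measure_empty mult.commute negligible_convex_frontier)
  qed
  ultimately have "B \<subseteq> \<Union>(T ` X)"
    using convex_closure_interior[OF cB(2)] closure_subset[of B] by auto
  moreover have "3 *\<^sub>R y \<in> B" using y by (auto simp: B_def)
  ultimately obtain x where "x \<in> X" "3 *\<^sub>R y \<in> T x" by blast
  then show "\<exists>x\<in>X. \<exists>p\<in>Q. 3 *\<^sub>R y = 2 *\<^sub>R x + p" unfolding T_def by (metis imageE)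
qed

section \<open>Feasible directions\<close>

definition feasible :: "'a::euclidean_space set \<Rightarrow> 'a \<Rightarrow> 'a \<Rightarrow> bool" where
  "feasible P p y \<longleftrightarrow> (\<exists>t>0. p + t *\<^sub>R y \<in> P)"

lemma convex_shrink_step:
  assumes "convex P" "p \<in> P" "p + t *\<^sub>R y \<in> P" "0 \<le> s" "s \<le> t"
  shows "p + s *\<^sub>R y \<in> P"
proof (cases "t = 0")
  case False
  then have t: "t > 0" using assms by simp
  have "(1 - s/t) *\<^sub>R p + (s/t) *\<^sub>R (p + t *\<^sub>R y) \<in> P"
    using assms t by (intro convexD) auto
  also have "(1 - s/t) *\<^sub>R p + (s/t) *\<^sub>R (p + t *\<^sub>R y) = p + s *\<^sub>R y"
    using t by (simp add: algebra_simps)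
  finally show ?thesis .
qed (use assms in auto)

lemma feasible_zero: "p \<in> P \<Longrightarrow> feasible P p 0"
  unfolding feasible_def by (auto intro: exI[of _ 1])

lemma feasible_toward: "q \<in> P \<Longrightarrow> feasible P p (q - p)"
  unfolding feasible_def by (auto intro!: exI[of _ 1])

lemma feasible_scale:
  assumes "feasible P p y" "p \<in> P" "c \<ge> 0"
  shows "feasible P p (c *\<^sub>R y)"
proof (cases "c = 0")
  case False
  then obtain t where "t > 0" "p + t *\<^sub>R y \<in> P" "c > 0"
    using assms unfolding feasible_def by auto
  then show ?thesis unfolding feasible_def by (intro exI[of _ "t / c"]) auto
qed (use assms feasible_zero in auto)

lemma feasible_add:
  assumes "convex P" "p \<in> P" "feasible P p y" "feasible P p z"
  shows "feasible P p (y + z)"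
proof -
  obtain s t where st: "s > 0" "p + s *\<^sub>R y \<in> P" "t > 0" "p + t *\<^sub>R z \<in> P"
    using assms(3,4) unfolding feasible_def by auto
  define m where "m = min s t"
  have "p + m *\<^sub>R y \<in> P" "p + m *\<^sub>R z \<in> P"
    using convex_shrink_step[OF assms(1,2) st(2)] convex_shrink_step[OF assms(1,2) st(4)] st
    by (auto simp: m_def)
  then have "(1/2) *\<^sub>R (p + m *\<^sub>R y) + (1/2) *\<^sub>R (p + m *\<^sub>R z) \<in> P"
    using assms(1) by (intro convexD) auto
  also have "(1/2) *\<^sub>R (p + m *\<^sub>R y) + (1/2) *\<^sub>R (p + m *\<^sub>R z) = p + (m/2) *\<^sub>R (y + z)"
    by (simp add: algebra_simps flip: scaleR_add_left)
  finally show ?thesis using st unfolding feasible_def m_def by (intro exI[of _ "min s t / 2"]) auto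
qed

lemma feasible_sum:
  assumes "convex P" "p \<in> P" "finite Y" "\<And>a. a \<in> Y \<Longrightarrow> feasible P p (g a)"
  shows "feasible P p (\<Sum>a\<in>Y. g a)"
  using assms(3,4) by (induction) (auto intro: feasible_zero feasible_add assms)

lemma closed_limit_along:
  fixes P :: "'a::euclidean_space set"
  assumes "closed P" "c > 0" "\<And>d. 0 < d \<Longrightarrow> d \<le> c \<Longrightarrow> p + d *\<^sub>R a \<in> P"
  shows "p \<in> P"
proof -
  have "((\<lambda>d. p + d *\<^sub>R a) \<longlongrightarrow> p + 0 *\<^sub>R a) (at_right 0)"
    by (intro tendsto_intros)
  moreover have "\<forall>\<^sub>F d in at_right 0. p + d *\<^sub>R a \<in> P"
    using assms(2,3) by (auto simp: eventually_at_right_field intro!: exI[of _ c])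
  ultimately show ?thesis
    using Lim_in_closed_set[OF assms(1), of "\<lambda>d. p + d *\<^sub>R a" "at_right 0"] by auto
qed

section \<open>Edges of a polytope whose triple is tiled by its translates\<close>

text \<open>The extremal situation: \<open>3 P\<close> is tiled by the translates \<open>2 x + P\<close>, where \<open>x\<close> runs over a
finite set that spans \<open>P\<close>. Disjointness of the interiors of the tiles is expressed through the
difference body.\<close>

locale self_tiling =
  fixes X P :: "'a::euclidean_space set"
  assumes finite_X: "finite X" and hull_X: "P = convex hull X" and interior_P: "interior P \<noteq> {}"
    and cover: "y \<in> P \<Longrightarrow> \<exists>x\<in>X. \<exists>p\<in>P. 3 *\<^sub>R y = 2 *\<^sub>R x + p"
    and packed: "x \<in> X \<Longrightarrow> y \<in> X \<Longrightarrow> x \<noteq> y \<Longrightarrow> 2 *\<^sub>R (x - y) \<notin> interior (difference_body P)"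
begin

lemma X_subset_P: "X \<subseteq> P" using hull_X hull_subset by metis
lemma polytope_P: "polytope P" using finite_X hull_X polytope_def by blast
lemma convex_P: "convex P" using hull_X by simp
lemma compact_P: "compact P" using polytope_P polytope_imp_compact by blast
lemma closed_P: "closed P" using compact_P compact_imp_closed by blast

lemma extreme_point_in_X: "v extreme_point_of P \<Longrightarrow> v \<in> X"
  using hull_X extreme_point_of_convex_hull by blast

text \<open>A point \<open>3 y\<close> of the tile \<open>2 x + P\<close> makes \<open>y\<close> a proper convex combination of \<open>x\<close> and a
point of \<open>P\<close>. So a tile that reaches the face \<open>3 F\<close> of \<open>3 P\<close> does so along its own copy of
\<open>F\<close>, and its translation vector lies on that face.\<close>

lemma tile_meeting_face:
  assumes F: "F face_of P" "y \<in> F" and "x \<in> X" "p \<in> P" "3 *\<^sub>R y = 2 *\<^sub>R x + p"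
  shows "x \<in> F" "p \<in> F"
proof -
  have y: "y = (1 - 1/3) *\<^sub>R x + (1/3) *\<^sub>R p"
  proof -
    have "y = (1/3) *\<^sub>R (3 *\<^sub>R y)" by simp
    also have "\<dots> = (1/3) *\<^sub>R (2 *\<^sub>R x + p)" using assms(5) by metis
    finally show ?thesis by (simp add: algebra_simps)
  qed
  have xP: "x \<in> P" using X_subset_P assms by auto
  have "x \<in> F \<and> p \<in> F"
  proof (cases "x = p")
    case True
    then have "y = x" using y by (simp flip: scaleR_add_left)
    then show ?thesis using True F by auto
  next
    case False
    then have "y \<in> open_segment x p" unfolding in_segment using y by (auto intro!: exI[of _ "1/3"])
    then show ?thesis using face_ofD[OF F(1) _ xP assms(4)] F(2) by blast
  qed
  then show "x \<in> F" "p \<in> F" by auto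
qed

lemma edge_endpoints_extreme:
  assumes "closed_segment v w face_of P"
  shows "v extreme_point_of P" "w extreme_point_of P"
  by (metis assms ends_in_segment extreme_point_of_face extreme_point_of_segment)+

text \<open>The point \<open>2 v + w\<close> of the tripled edge is the far end of the tile \<open>2 v + P\<close>. Any other tile
at this point comes from some \<open>x\<close> on the edge at most halfway along it, and \<open>x\<close> has to be far
enough from \<open>v\<close> to be packed next to it; only the midpoint remains. The lemma
describes \<open>3 P\<close> near this point: the first alternative is the tile at \<open>v\<close>, the second
the tile at the midpoint.\<close>

lemma tiles_at_edge_breakpoint:
  assumes E: "closed_segment v w face_of P" "v \<noteq> w"
  obtains e where "e > 0"
    "\<And>y z. z \<in> P \<Longrightarrow> 3 *\<^sub>R z = 2 *\<^sub>R v + w + y \<Longrightarrow> norm y < e \<Longrightarrow>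
       w + y \<in> P \<or> (midpoint v w \<in> X \<and> v + y \<in> P)"
proof -
  define r where "r = 2 *\<^sub>R v + w"
  define U where "U = (\<Union>x\<in>X - {v, midpoint v w}. (+) (2 *\<^sub>R x) ` P)"
  have vw: "v \<in> P" "w \<in> P" using face_of_imp_subset[OF E(1)] by auto
  have vX: "v \<in> X" using edge_endpoints_extreme[OF E(1)] extreme_point_in_X by blast
  have "closed U" unfolding U_def
    using finite_X closed_P by (intro closed_UN) (auto intro: closed_translation)
  moreover have "r \<notin> U"
  proof
    assume "r \<in> U"
    then obtain x p where x: "x \<in> X" "x \<noteq> v" "x \<noteq> midpoint v w" "p \<in> P" "r = 2 *\<^sub>R x + p"
      by (auto simp: U_def)
    have "(1/3) *\<^sub>R r \<in> closed_segment v w"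
      unfolding in_segment r_def by (intro exI[of _ "1/3"]) (auto simp: algebra_simps simp flip: scaleR_add_left)
    then have "x \<in> closed_segment v w" "p \<in> closed_segment v w"
      using tile_meeting_face[OF E(1) _ x(1,4), of "(1/3) *\<^sub>R r"] x(5) by auto
    then obtain s t where s: "x = (1 - s) *\<^sub>R v + s *\<^sub>R w" "0 \<le> s" "s \<le> 1"
      and t: "p = (1 - t) *\<^sub>R v + t *\<^sub>R w" "0 \<le> t" "t \<le> 1"
      unfolding in_segment by auto
    have "(2 * s + t - 1) *\<^sub>R (w - v) = 0"
      using x(5) s(1) t(1) by (simp add: r_def algebra_simps)
    then have st: "2 * s = 1 - t" using E(2) by auto
    have "s \<noteq> 0" using s x(2) by auto
    moreover have "s \<noteq> 1/2"
    proof
      assume "s = 1/2"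
      then have "x = midpoint v w"
        unfolding s(1) \<open>s = 1/2\<close> by (simp add: midpoint_def scaleR_add_right)
      then show False using x(3) by simp
    qed
    ultimately have s2: "0 < 2 * s" "2 * s < 1" using st s t by linarith+
    have "(w - v) - (1 - 2 * s) *\<^sub>R ((w - v) - 0) \<in> interior (difference_body P)"
      using s2 vw interior_P convex_P
      by (intro mem_interior_convex_shrink convex_difference_body
           zero_in_interior_difference_body difference_bodyI) auto
    also have "(w - v) - (1 - 2 * s) *\<^sub>R ((w - v) - 0) = 2 *\<^sub>R (s *\<^sub>R (w - v))"
      by (simp add: scaleR_left_diff_distrib)
    also have "s *\<^sub>R (w - v) = x - v" using s(1) by (simp add: algebra_simps)
    finally show False using packed[OF x(1) vX x(2)] by blast
  qed
  ultimately obtain e where e: "e > 0" "ball r e \<subseteq> - U"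
    by (metis ComplI open_Compl open_contains_ball)
  show ?thesis
  proof
    show "e > 0" by fact
    fix y z assume z: "z \<in> P" "3 *\<^sub>R z = 2 *\<^sub>R v + w + y" "norm y < e"
    then obtain x p where x: "x \<in> X" "p \<in> P" "3 *\<^sub>R z = 2 *\<^sub>R x + p" using cover by blast
    have "r + y \<in> ball r e" using z by (simp add: dist_norm)
    then have "2 *\<^sub>R x + p \<notin> U" using e z x by (auto simp: r_def)
    then have "x = v \<or> x = midpoint v w" using x unfolding U_def by blast
    then show "w + y \<in> P \<or> (midpoint v w \<in> X \<and> v + y \<in> P)"
    proof
      assume "x = v"
      then have "w + y = p" using x(3) z(2) by (simp add: algebra_simps)
      then show ?thesis using x by simp
    next
      assume m: "x = midpoint v w"
      then have "v + y = p" using x(3) z(2) by (simp add: algebra_simps midpoint_def scaleR_2)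
      then show ?thesis using x m by simp
    qed
  qed
qed

text \<open>Otherwise, the tile \<open>2 v + P\<close> alone would cover the tripled edge a little beyond \<open>2 v + w\<close>,
and the edge would extend beyond \<open>w\<close>.\<close>

lemma edge_midpoint_in_X:
  assumes E: "closed_segment v w face_of P" "v \<noteq> w"
  shows "midpoint v w \<in> X"
proof (rule ccontr)
  assume nm: "midpoint v w \<notin> X"
  obtain e where e: "e > 0"
    and near: "\<And>y z. z \<in> P \<Longrightarrow> 3 *\<^sub>R z = 2 *\<^sub>R v + w + y \<Longrightarrow> norm y < e \<Longrightarrow>
       w + y \<in> P \<or> (midpoint v w \<in> X \<and> v + y \<in> P)"
    using tiles_at_edge_breakpoint[OF E] by metis
  define d where "d = min 1 (e / (2 * norm (w - v)))"
  have d: "0 < d" "d \<le> 1" using e E(2) by (auto simp: d_def)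
  have "d * norm (w - v) \<le> (e / (2 * norm (w - v))) * norm (w - v)"
    by (intro mult_right_mono) (auto simp: d_def)
  also have "\<dots> < e" using e E(2) by simp
  finally have dn: "norm (d *\<^sub>R (w - v)) < e" using d by simp
  define k where "k = (1 + d) / 3"
  have k: "3 * k = 1 + d" by (simp add: k_def)
  define z where "z = (1 - k) *\<^sub>R v + k *\<^sub>R w"
  have "z \<in> closed_segment v w" unfolding in_segment z_def
    using d by (intro exI[of _ k]) (auto simp: k_def)
  then have "z \<in> P" using face_of_imp_subset[OF E(1)] by blast
  moreover have "3 *\<^sub>R z = 2 *\<^sub>R v + w + d *\<^sub>R (w - v)"
  proof -
    have "3 *\<^sub>R z = (3 - 3 * k) *\<^sub>R v + (3 * k) *\<^sub>R w" by (simp add: z_def algebra_simps)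
    then show ?thesis unfolding k by (simp add: algebra_simps scaleR_2)
  qed
  ultimately have wP: "w + d *\<^sub>R (w - v) \<in> P" using near nm dn by blast
  have vP: "v \<in> P" using face_of_imp_subset[OF E(1)] by auto
  have "w \<in> open_segment v (w + d *\<^sub>R (w - v))"
  proof -
    have "w + d *\<^sub>R (w - v) - v = (1 + d) *\<^sub>R (w - v)" by (simp add: algebra_simps)
    then have "v \<noteq> w + d *\<^sub>R (w - v)" using d E(2) by auto
    moreover have "w = (1 - 1 / (1 + d)) *\<^sub>R v + (1 / (1 + d)) *\<^sub>R (w + d *\<^sub>R (w - v))"
    proof -
      have "(1 - 1 / (1 + d)) *\<^sub>R v + (1 / (1 + d)) *\<^sub>R (w + d *\<^sub>R (w - v))
          = v + (1 / (1 + d)) *\<^sub>R ((1 + d) *\<^sub>R (w - v))" by (simp add: algebra_simps)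
      then show ?thesis using d by simp
    qed
    ultimately show ?thesis unfolding in_segment using d by (auto intro!: exI[of _ "1 / (1 + d)"])
  qed
  then have "w + d *\<^sub>R (w - v) \<in> closed_segment v w"
    using face_ofD[OF E(1) _ vP wP] by auto
  then obtain l where l: "w + d *\<^sub>R (w - v) = (1 - l) *\<^sub>R v + l *\<^sub>R w" "l \<le> 1"
    unfolding in_segment by auto
  have "(1 + d - l) *\<^sub>R (w - v) = 0" using l(1) by (simp add: algebra_simps)
  then show False using E(2) d l(2) by auto
qed

text \<open>The tiles at \<open>v\<close> and at the midpoint differ by the edge vector, which therefore is not interior
to the difference body. A supporting functional there shows that the edge is an affine diameter:
its end points lie on parallel supporting hyperplanes of \<open>P\<close>.\<close>

lemma edge_width_functional:
  assumes E: "closed_segment v w face_of P" "v \<noteq> w"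
  obtains n where "n \<bullet> (w - v) = 1" "\<And>p. p \<in> P \<Longrightarrow> n \<bullet> v \<le> n \<bullet> p \<and> n \<bullet> p \<le> n \<bullet> w"
proof -
  let ?D = "difference_body P"
  have vw: "v \<in> P" "w \<in> P" using face_of_imp_subset[OF E(1)] by auto
  have "2 *\<^sub>R (midpoint v w - v) = w - v" by (simp add: midpoint_def algebra_simps scaleR_2)
  moreover have "midpoint v w \<noteq> v" using E(2) by (simp add: midpoint_eq_endpoint)
  ultimately have notin: "w - v \<notin> interior ?D"
    using packed[OF edge_midpoint_in_X[OF E] extreme_point_in_X[OF edge_endpoints_extreme(1)[OF E(1)]]]
    by simp
  have z: "0 \<in> interior ?D" using interior_P zero_in_interior_difference_body by blast
  have cD: "convex ?D" using convex_P convex_difference_body by blast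
  obtain u b where u: "u \<noteq> 0" "\<forall>x\<in>interior ?D. u \<bullet> x \<le> b" "\<forall>x\<in>{w - v}. u \<bullet> x \<ge> b"
    using separating_hyperplane_sets[of "interior ?D" "{w - v}"] cD z notin
    by (auto simp: convex_interior)
  obtain e where e: "e > 0" "ball 0 e \<subseteq> interior ?D"
    using z by (metis open_contains_ball open_interior)
  have "(e / (2 * norm u)) *\<^sub>R u \<in> interior ?D" using e u(1) by (intro subsetD[OF e(2)]) auto
  then have "u \<bullet> ((e / (2 * norm u)) *\<^sub>R u) \<le> b" using u(2) by blast
  moreover have "u \<bullet> ((e / (2 * norm u)) *\<^sub>R u) > 0" using e u(1) by simp
  ultimately have pos: "u \<bullet> (w - v) > 0" using u(3) by auto
  have all: "u \<bullet> x \<le> u \<bullet> (w - v)" if "x \<in> ?D" for x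
  proof -
    have "?D \<subseteq> closure (interior ?D)" using convex_closure_interior[OF cD] z closure_subset by fastforce
    moreover have "closure (interior ?D) \<subseteq> {x. u \<bullet> x \<le> b}"
      using u(2) by (intro closure_minimal closed_halfspace_le) auto
    ultimately have "u \<bullet> x \<le> b" using that by auto
    then show ?thesis using u(3) by auto
  qed
  define n where "n = (1 / (u \<bullet> (w - v))) *\<^sub>R u"
  have n: "n \<bullet> x = u \<bullet> x / (u \<bullet> (w - v))" for x by (simp add: n_def)
  show ?thesis
  proof
    show "n \<bullet> (w - v) = 1" using pos n by simp
    fix p assume p: "p \<in> P"
    have "u \<bullet> (p - v) \<le> u \<bullet> (w - v)" "u \<bullet> (w - p) \<le> u \<bullet> (w - v)"
      using all difference_bodyI p vw by blast+
    then show "n \<bullet> v \<le> n \<bullet> p \<and> n \<bullet> p \<le> n \<bullet> w"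
      unfolding n using pos by (auto simp: inner_diff_right divide_right_mono)
  qed
qed

text \<open>The key step. Just next to \<open>2 v + w\<close>, the body \<open>3 P\<close> is the union of two tiles, which look
like \<open>P\<close> near \<open>w\<close> and like \<open>P\<close> near \<open>v\<close>, and which are separated by the hyperplane of
the width functional \<open>n\<close>. On the other hand \<open>3 P\<close> is invariant there under small shifts along
the edge. So both feasible cones have the same section by the hyperplane \<open>n = 0\<close>, and each is
the sum of this section and the ray along the edge that points into \<open>P\<close>.\<close>

lemma edge_splits_feasible_cones:
  assumes E: "closed_segment v w face_of P" "v \<noteq> w"
  obtains n where "n \<bullet> (w - v) = 1" "\<And>p. p \<in> P \<Longrightarrow> n \<bullet> v \<le> n \<bullet> p \<and> n \<bullet> p \<le> n \<bullet> w"
    "\<And>y. feasible P v y \<or> feasible P w y \<Longrightarrow>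
       feasible P v (y - (n \<bullet> y) *\<^sub>R (w - v)) \<and> feasible P w (y - (n \<bullet> y) *\<^sub>R (w - v))"
proof -
  obtain n where n: "n \<bullet> (w - v) = 1" and
    nP: "\<And>p. p \<in> P \<Longrightarrow> n \<bullet> v \<le> n \<bullet> p \<and> n \<bullet> p \<le> n \<bullet> w"
    using edge_width_functional[OF E] by metis
  obtain e where e: "e > 0"
    and near: "\<And>y z. z \<in> P \<Longrightarrow> 3 *\<^sub>R z = 2 *\<^sub>R v + w + y \<Longrightarrow> norm y < e \<Longrightarrow>
       w + y \<in> P \<or> (midpoint v w \<in> X \<and> v + y \<in> P)"
    using tiles_at_edge_breakpoint[OF E] by metis
  have vw: "v \<in> P" "w \<in> P" using face_of_imp_subset[OF E(1)] by auto
  define a where "a = w - v"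
  define r where "r = (2/3) *\<^sub>R v + (1/3) *\<^sub>R w"
  have rP: "r \<in> P" unfolding r_def using vw convex_P by (intro convexD) auto
  have r3: "3 *\<^sub>R r = 2 *\<^sub>R v + w" by (simp add: r_def algebra_simps)
  have na: "n \<bullet> a = 1" using n by (simp add: a_def)
  have "feasible P v (y - (n \<bullet> y) *\<^sub>R a) \<and> feasible P w (y - (n \<bullet> y) *\<^sub>R a)"
    if fy: "feasible P v y \<or> feasible P w y" for y
  proof -
    \<comment> \<open>The point \<open>r\<close> lies inside the edge, so both \<open>a\<close> and \<open>- a\<close> are feasible there.
      A direction feasible at either end is feasible at \<open>r\<close>, and so is its projection \<open>h\<close>.\<close>
    define h where "h = y - (n \<bullet> y) *\<^sub>R a"
    have nh: "n \<bullet> h = 0" by (simp add: h_def inner_diff_right na)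
    have pa: "feasible P r a"
      unfolding feasible_def
    proof (intro exI[of _ "2/3"] conjI)
      have "r + (2/3) *\<^sub>R a = w" by (simp add: r_def a_def algebra_simps flip: scaleR_add_left)
      then show "r + (2/3) *\<^sub>R a \<in> P" using vw by simp
    qed simp
    have ma: "feasible P r (- a)"
      unfolding feasible_def
    proof (intro exI[of _ "1/3"] conjI)
      have "r + (1/3) *\<^sub>R (- a) = v" by (simp add: r_def a_def algebra_simps flip: scaleR_add_left)
      then show "r + (1/3) *\<^sub>R (- a) \<in> P" using vw by simp
    qed simp
    have ra: "feasible P r (c *\<^sub>R a)" for c
      using feasible_scale[OF pa rP, of c] feasible_scale[OF ma rP, of "- c"]
      by (cases "c \<ge> 0") auto
    have fr: "feasible P r y"
      using fy
    proof
      assume "feasible P v y"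
      then obtain t where t: "t > 0" "v + t *\<^sub>R y \<in> P" by (auto simp: feasible_def)
      have "(2/3) *\<^sub>R (v + t *\<^sub>R y) + (1/3) *\<^sub>R w \<in> P" using t vw convex_P by (intro convexD) auto
      also have "(2/3) *\<^sub>R (v + t *\<^sub>R y) + (1/3) *\<^sub>R w = r + (2/3 * t) *\<^sub>R y"
        by (simp add: r_def algebra_simps)
      finally show ?thesis unfolding feasible_def using t by (intro exI[of _ "2/3 * t"]) auto
    next
      assume "feasible P w y"
      then obtain t where t: "t > 0" "w + t *\<^sub>R y \<in> P" by (auto simp: feasible_def)
      have "(2/3) *\<^sub>R v + (1/3) *\<^sub>R (w + t *\<^sub>R y) \<in> P" using t vw convex_P by (intro convexD) auto
      also have "(2/3) *\<^sub>R v + (1/3) *\<^sub>R (w + t *\<^sub>R y) = r + (1/3 * t) *\<^sub>R y"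
        by (simp add: r_def algebra_simps)
      finally show ?thesis unfolding feasible_def using t by (intro exI[of _ "1/3 * t"]) auto
    qed
    have fh: "feasible P r (h + c *\<^sub>R a)" for c
      using feasible_add[OF convex_P rP fr ra[of "c - n \<bullet> y"]] by (simp add: h_def algebra_simps)
    obtain t1 t2 where t1: "t1 > 0" "r + t1 *\<^sub>R (h + 1 *\<^sub>R a) \<in> P"
      and t2: "t2 > 0" "r + t2 *\<^sub>R (h + (-1) *\<^sub>R a) \<in> P"
      using fh[of 1] fh[of "-1"] unfolding feasible_def by metis
    define t where "t = min (min t1 t2) (e / (6 * (norm h + norm a)))"
    have "a \<noteq> 0" using E(2) by (simp add: a_def)
    then have na0: "norm h + norm a > 0" by (simp add: add_nonneg_pos)
    then have t: "t > 0" "t \<le> t1" "t \<le> t2" "t \<le> e / (6 * (norm h + norm a))"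
      using t1 t2 e by (auto simp: t_def)
    have key: "w + 3 *\<^sub>R (t *\<^sub>R h + d *\<^sub>R a) \<in> P \<or> v + 3 *\<^sub>R (t *\<^sub>R h + d *\<^sub>R a) \<in> P"
      if d: "\<bar>d\<bar> \<le> t" for d
    proof -
      have 1: "r + t *\<^sub>R (h + 1 *\<^sub>R a) \<in> P" "r + t *\<^sub>R (h + (-1) *\<^sub>R a) \<in> P"
        using convex_shrink_step[OF convex_P rP t1(2)] convex_shrink_step[OF convex_P rP t2(2)] t
        by auto
      define l m where "l = (1 + d / t) / 2" and "m = (1 - d / t) / 2"
      have l: "0 \<le> l" "0 \<le> m" "l + m = 1" and lm: "(l - m) * t = d"
        using d t by (auto simp: l_def m_def field_simps abs_le_iff)
      have "l *\<^sub>R (r + t *\<^sub>R (h + 1 *\<^sub>R a)) + m *\<^sub>R (r + t *\<^sub>R (h + (-1) *\<^sub>R a)) \<in> P"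
        using l 1 convex_P by (intro convexD) auto
      also have "l *\<^sub>R (r + t *\<^sub>R (h + 1 *\<^sub>R a)) + m *\<^sub>R (r + t *\<^sub>R (h + (-1) *\<^sub>R a))
          = (l + m) *\<^sub>R (r + t *\<^sub>R h) + ((l - m) * t) *\<^sub>R a" by (simp add: algebra_simps)
      also have "\<dots> = r + t *\<^sub>R h + d *\<^sub>R a" using l lm by simp
      finally have zP: "r + t *\<^sub>R h + d *\<^sub>R a \<in> P" .
      have "norm (3 *\<^sub>R (t *\<^sub>R h + d *\<^sub>R a)) \<le> 3 * (t * norm h + \<bar>d\<bar> * norm a)"
        using norm_triangle_ineq[of "t *\<^sub>R h" "d *\<^sub>R a"] t by simp
      also have "\<dots> \<le> 3 * (t * norm h + t * norm a)" using d by (simp add: mult_right_mono)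
      also have "\<dots> = 3 * t * (norm h + norm a)" by (simp add: algebra_simps)
      also have "\<dots> \<le> 3 * (e / (6 * (norm h + norm a))) * (norm h + norm a)"
        using t na0 by (intro mult_right_mono mult_left_mono) auto
      also have "\<dots> < e"
      proof -
        have "3 * (e / (6 * M)) * M < e" if "M > 0" for M using that e by simp
        then show ?thesis using na0 by blast
      qed
      finally have "norm (3 *\<^sub>R (t *\<^sub>R h + d *\<^sub>R a)) < e" .
      moreover have "3 *\<^sub>R (r + t *\<^sub>R h + d *\<^sub>R a) = 2 *\<^sub>R v + w + 3 *\<^sub>R (t *\<^sub>R h + d *\<^sub>R a)"
        using r3 by (simp add: algebra_simps)
      ultimately show ?thesis using near[OF zP] by blast
    qed
    have nw: "n \<bullet> w = n \<bullet> v + 1" using n by (simp add: inner_diff_right)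
    \<comment> \<open>Tilting \<open>h\<close> slightly forward leaves the tile at \<open>v\<close>, tilting it slightly backward
      leaves the tile at the midpoint; the limit then lies in the other one.\<close>
    have "v + (3 * t) *\<^sub>R h \<in> P"
    proof (rule closed_limit_along[OF closed_P, where c = "3 * t" and a = a])
      fix d :: real assume d: "0 < d" "d \<le> 3 * t"
      have "w + 3 *\<^sub>R (t *\<^sub>R h + (d/3) *\<^sub>R a) \<notin> P"
        using nP[of "w + 3 *\<^sub>R (t *\<^sub>R h + (d/3) *\<^sub>R a)"] d nh na by (auto simp: inner_add_right)
      then show "v + (3 * t) *\<^sub>R h + d *\<^sub>R a \<in> P"
        using key[of "d/3"] d by (simp add: algebra_simps)
    qed (use t in simp)
    moreover have "w + (3 * t) *\<^sub>R h \<in> P"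
    proof (rule closed_limit_along[OF closed_P, where c = "3 * t" and a = "- a"])
      fix d :: real assume d: "0 < d" "d \<le> 3 * t"
      have "v + 3 *\<^sub>R (t *\<^sub>R h + (- d/3) *\<^sub>R a) \<notin> P"
        using nP[of "v + 3 *\<^sub>R (t *\<^sub>R h + (- d/3) *\<^sub>R a)"] d nh na
        by (auto simp: inner_add_right inner_diff_right)
      then show "w + (3 * t) *\<^sub>R h + d *\<^sub>R (- a) \<in> P"
        using key[of "- d/3"] d by (simp add: algebra_simps)
    qed (use t in simp)
    ultimately show ?thesis using t unfolding h_def feasible_def
      by (auto intro!: exI[of _ "3 * t"])
  qed
  then show ?thesis using that[OF n nP] by (simp add: a_def)
qed

end

section \<open>The vertex figure is simplicial\<close>

text \<open>Among the faces that properly contain the vertex, one of least dimension is an edge: any facet of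
it through the vertex must be the vertex itself.\<close>

lemma polytope_edge_at_vertex:
  fixes F :: "'a::euclidean_space set"
  assumes "polytope F" "v extreme_point_of F" "F \<noteq> {v}"
  obtains w where "w \<noteq> v" "closed_segment v w face_of F"
proof -
  define ok where "ok G \<longleftrightarrow> G face_of F \<and> v \<in> G \<and> G \<noteq> {v}" for G
  have "ok F" using assms by (simp add: ok_def face_of_refl polytope_imp_convex extreme_point_of_def)
  then obtain G where G: "ok G" and least: "\<And>H. ok H \<Longrightarrow> nat (aff_dim G) \<le> nat (aff_dim H)"
    using ex_has_least_nat[of ok F "\<lambda>G. nat (aff_dim G)"] by auto
  have GF: "G face_of F" "v \<in> G" "G \<noteq> {v}" using G by (auto simp: ok_def)
  have polyG: "polytope G" using GF assms(1) face_of_polytope_polytope by blast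
  have vG: "v extreme_point_of G" using extreme_point_of_face[OF GF(1)] assms GF by auto
  then have "v \<in> G - rel_interior G" using extreme_point_not_in_REL_INTERIOR GF by blast
  then obtain H where H: "H facet_of G" "v \<in> H"
    using rel_boundary_of_polyhedron[OF polytope_imp_polyhedron[OF polyG]] by blast
  have dimH: "aff_dim H = aff_dim G - 1" using H(1) by (simp add: facet_of_def)
  have "aff_dim H \<ge> 0" using H(2) aff_dim_negative_iff[of H] by (metis empty_iff not_le)
  have "H = {v}"
  proof (rule ccontr)
    assume "H \<noteq> {v}"
    then have "ok H" using H GF facet_of_imp_face_of face_of_trans unfolding ok_def by blast
    then show False using least[of H] dimH \<open>aff_dim H \<ge> 0\<close> by auto
  qed
  then have "aff_dim G = 1" using dimH by simp
  then have "collinear G" by (simp add: collinear_aff_dim)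
  then obtain a b where ab: "G = closed_segment a b"
    using compact_convex_collinear_segment[of G] GF polyG polytope_imp_compact polytope_imp_convex
    by (metis empty_iff)
  have "v = a \<or> v = b" using vG by (simp add: ab extreme_point_of_segment)
  moreover have "a \<noteq> b" using ab GF by auto
  ultimately show ?thesis
    using that[of a] that[of b] ab GF by (auto simp: closed_segment_commute)
qed

context self_tiling
begin

text \<open>Each edge ray splits off from the feasible cone at \<open>v\<close> as a direct summand, so the width
functional of one edge vanishes on the other edges, and the edges with their functionals are dual
systems. Splitting off all edges from a feasible direction leaves a feasible direction on which all
the functionals vanish. If it were nonzero, the face of \<open>P\<close> on which all functionals agree
with \<open>v\<close> would contain a further edge at \<open>v\<close>, on which its own functional is 1. Hence the
edges span, and the cone is the simplicial cone generated by them.\<close>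

lemma edges_at_vertex_form_basis:
  assumes v: "v extreme_point_of P"
  obtains Y N where "finite Y" "independent Y" "card Y = DIM('a)"
    "\<And>a. a \<in> Y \<Longrightarrow> N a \<bullet> a = (1::real)" "\<And>a b. a \<in> Y \<Longrightarrow> b \<in> Y \<Longrightarrow> a \<noteq> b \<Longrightarrow> N a \<bullet> b = 0"
    "\<And>y. y = (\<Sum>a\<in>Y. (N a \<bullet> y) *\<^sub>R a)"
    "\<And>a. a \<in> Y \<Longrightarrow> closed_segment v (v + a) face_of P"
    "\<And>a p. a \<in> Y \<Longrightarrow> p \<in> P \<Longrightarrow> N a \<bullet> v \<le> N a \<bullet> p \<and> N a \<bullet> p \<le> N a \<bullet> v + 1"
    "\<And>y. feasible P v y \<longleftrightarrow> (\<forall>a\<in>Y. N a \<bullet> y \<ge> 0)"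
proof -
  have vP: "v \<in> P" using v by (simp add: extreme_point_of_def)
  define Y where "Y = {a. a \<noteq> 0 \<and> closed_segment v (v + a) face_of P}"
  define good where "good a n \<longleftrightarrow> n \<bullet> a = 1 \<and> (\<forall>p\<in>P. n \<bullet> v \<le> n \<bullet> p \<and> n \<bullet> p \<le> n \<bullet> v + 1) \<and>
     (\<forall>y. feasible P v y \<longrightarrow> feasible P v (y - (n \<bullet> y) *\<^sub>R a))" for a n
  have "\<exists>n. good a n" if "a \<in> Y" for a
  proof -
    have a: "closed_segment v (v + a) face_of P" "v \<noteq> v + a" using that by (auto simp: Y_def)
    show ?thesis
      by (rule edge_splits_feasible_cones[OF a]) (auto simp: good_def inner_add_right)
  qed
  then obtain N where N: "\<And>a. a \<in> Y \<Longrightarrow> good a (N a)" by metis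
  have Naa: "N a \<bullet> a = 1" if "a \<in> Y" for a using N[OF that] by (simp add: good_def)
  have NP: "N a \<bullet> v \<le> N a \<bullet> p \<and> N a \<bullet> p \<le> N a \<bullet> v + 1" if "a \<in> Y" "p \<in> P" for a p
    using N[OF that(1)] that(2) by (simp add: good_def)
  have split: "feasible P v (y - (N a \<bullet> y) *\<^sub>R a)" if "a \<in> Y" "feasible P v y" for a y
    using N[OF that(1)] that(2) by (simp add: good_def)
  have Nf: "N a \<bullet> y \<ge> 0" if ay: "a \<in> Y" "feasible P v y" for a y
  proof -
    obtain t where t: "t > 0" "v + t *\<^sub>R y \<in> P" using ay by (auto simp: feasible_def)
    then have "0 \<le> t * (N a \<bullet> y)" using NP[OF ay(1) t(2)] by (simp add: inner_add_right)
    then show ?thesis using t(1) by (simp add: zero_le_mult_iff)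
  qed
  have edge: "closed_segment v (v + a) face_of P" "a \<noteq> 0" if "a \<in> Y" for a
    using that by (auto simp: Y_def)
  have Yf: "feasible P v a" if "a \<in> Y" for a
    using feasible_toward[of "v + a" P v] face_of_imp_subset[OF edge(1)[OF that]] by auto
  have Nab: "N a \<bullet> b = 0" if ab: "a \<in> Y" "b \<in> Y" "a \<noteq> b" for a b
  proof (rule ccontr)
    assume "N a \<bullet> b \<noteq> 0"
    then have pos: "N a \<bullet> b > 0" using Nf[OF ab(1) Yf[OF ab(2)]] by simp
    \<comment> \<open>If \<open>N a\<close> were positive on \<open>b\<close>, the splitting would write \<open>b\<close> as a sum of two feasible
      directions, one of them along \<open>a\<close>. The face property of the edge of \<open>b\<close> makes \<open>a\<close> and
      \<open>b\<close> parallel, and since both functionals have width 1 on \<open>P\<close>, they are equal.\<close>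
    define c where "c = N a \<bullet> b"
    define h where "h = b - c *\<^sub>R a"
    have "feasible P v h" using split[OF ab(1) Yf[OF ab(2)]] by (simp add: h_def c_def)
    moreover have "feasible P v (c *\<^sub>R a)"
      using feasible_scale[OF Yf[OF ab(1)] vP] pos by (simp add: c_def)
    ultimately obtain s t where s: "s > 0" "v + s *\<^sub>R h \<in> P" and t: "t > 0" "v + t *\<^sub>R (c *\<^sub>R a) \<in> P"
      by (auto simp: feasible_def)
    define m where "m = min 1 (min s t)"
    have m: "0 < m" "m \<le> s" "m \<le> t" "m \<le> 1" using s t by (auto simp: m_def)
    have hP: "v + m *\<^sub>R h \<in> P" using convex_shrink_step[OF convex_P vP s(2)] m by simp
    have aP: "v + m *\<^sub>R (c *\<^sub>R a) \<in> P" using convex_shrink_step[OF convex_P vP t(2)] m by simp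
    let ?p = "v + m *\<^sub>R h" and ?q = "v + m *\<^sub>R (c *\<^sub>R a)"
    have mid: "midpoint ?p ?q = v + (m/2) *\<^sub>R b"
      by (simp add: midpoint_def h_def algebra_simps scaleR_2 flip: scaleR_add_left)
    have seg: "midpoint ?p ?q \<in> closed_segment v (v + b)"
      unfolding mid in_segment using m by (intro exI[of _ "m/2"]) (auto simp: algebra_simps)
    have "?q \<in> closed_segment v (v + b)"
    proof (cases "?p = ?q")
      case True
      then show ?thesis using seg by (metis midpoint_idem)
    next
      case False
      then have "midpoint ?p ?q \<in> open_segment ?p ?q" by simp
      then show ?thesis using face_ofD[OF edge(1)[OF ab(2)] _ hP aP seg] by blast
    qed
    then obtain u where u: "?q = (1 - u) *\<^sub>R v + u *\<^sub>R (v + b)" by (auto simp: in_segment)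
    then have uab: "(m * c) *\<^sub>R a = u *\<^sub>R b" by (simp add: algebra_simps)
    have mc: "m * c > 0" using m pos by (simp add: c_def)
    have u0: "u \<noteq> 0" using uab mc edge(2)[OF ab(1)] by auto
    define k where "k = m * c / u"
    have "b = (1 / u) *\<^sub>R (u *\<^sub>R b)" using u0 by simp
    also have "\<dots> = k *\<^sub>R a" unfolding uab[symmetric] by (simp add: k_def)
    finally have bk: "b = k *\<^sub>R a" .
    have "c = k" using bk Naa[OF ab(1)] by (simp add: c_def)
    then have k: "k > 0" using pos c_def by simp
    have "N a \<bullet> (v + b) \<le> N a \<bullet> v + 1"
      using NP[OF ab(1)] face_of_imp_subset[OF edge(1)[OF ab(2)]] by auto
    then have "k \<le> 1" using bk Naa[OF ab(1)] by (simp add: inner_add_right)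
    have "N b \<bullet> a = 1 / k" using Naa[OF ab(2)] k bk by (simp add: field_simps)
    moreover have "N b \<bullet> (v + a) \<le> N b \<bullet> v + 1"
      using NP[OF ab(2)] face_of_imp_subset[OF edge(1)[OF ab(1)]] by auto
    ultimately have "1 / k \<le> 1" by (simp add: inner_add_right)
    then have "k = 1" using \<open>k \<le> 1\<close> k by simp
    then show False using bk ab(3) by simp
  qed
  have ind: "independent Y"
    unfolding dependent_def
  proof
    assume "\<exists>a\<in>Y. a \<in> span (Y - {a})"
    then obtain a where a: "a \<in> Y" "a \<in> span (Y - {a})" by blast
    have "N a \<bullet> x = 0" if "x \<in> span (Y - {a})" for x
      using that
    proof (induction rule: span_induct)
      case base
      show ?case by (auto simp: subspace_def inner_add_right)
    next
      case (step x)
      then show ?case using Nab[OF a(1), of x] by auto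
    qed
    then show False using Naa[OF a(1)] a(2) by fastforce
  qed
  have fin: "finite Y" using ind independent_imp_finite by blast
  have Nval: "N b \<bullet> a = (if a = b then 1 else 0)" if "a \<in> Y" "b \<in> Y" for a b
    using that Naa Nab by auto
  have Nsum: "N b \<bullet> (\<Sum>a\<in>Z. u a *\<^sub>R a) = u b" if "b \<in> Z" "Z \<subseteq> Y" for b u Z
  proof -
    have "N b \<bullet> (\<Sum>a\<in>Z. u a *\<^sub>R a) = (\<Sum>a\<in>Z. if a = b then u b else 0)"
      unfolding inner_sum_right using that Nval by (intro sum.cong) (auto simp: subset_iff)
    moreover have "finite Z" using that(2) fin by (rule finite_subset)
    ultimately show ?thesis using that by simp
  qed
  have Nsum0: "N b \<bullet> (\<Sum>a\<in>Z. u a *\<^sub>R a) = 0" if "b \<in> Y" "b \<notin> Z" "Z \<subseteq> Y" for b u Z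
    unfolding inner_sum_right using that Nab by (intro sum.neutral) fastforce
  have strip: "feasible P v (y - (\<Sum>a\<in>Z. (N a \<bullet> y) *\<^sub>R a))" if "feasible P v y" "Z \<subseteq> Y" for y Z
    using finite_subset[OF that(2) fin] that(2)
  proof (induction Z)
    case empty
    then show ?case using that by simp
  next
    case (insert b Z)
    define y' where "y' = y - (\<Sum>a\<in>Z. (N a \<bullet> y) *\<^sub>R a)"
    have "N b \<bullet> y' = N b \<bullet> y"
      using Nsum0[of b Z] insert by (simp add: y'_def inner_diff_right)
    then have "feasible P v (y' - (N b \<bullet> y) *\<^sub>R b)"
      using split[of b y'] insert by (simp add: y'_def)
    then show ?case using insert by (simp add: y'_def algebra_simps)
  qed
  have frep: "y = (\<Sum>a\<in>Y. (N a \<bullet> y) *\<^sub>R a)" if fy: "feasible P v y" for y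
  proof (rule ccontr)
    define z where "z = y - (\<Sum>a\<in>Y. (N a \<bullet> y) *\<^sub>R a)"
    assume "y \<noteq> (\<Sum>a\<in>Y. (N a \<bullet> y) *\<^sub>R a)"
    then have z0: "z \<noteq> 0" by (simp add: z_def)
    have Nz: "N a \<bullet> z = 0" if "a \<in> Y" for a using Nsum[OF that] by (simp add: z_def inner_diff_right)
    have "feasible P v z" unfolding z_def using strip[OF fy] by simp
    then obtain t where t: "t > 0" "v + t *\<^sub>R z \<in> P" by (auto simp: feasible_def)
    define F where "F = \<Inter>(insert P ((\<lambda>a. P \<inter> {p. N a \<bullet> p = N a \<bullet> v}) ` Y))"
    have FP: "F face_of P" unfolding F_def
      using convex_P NP by (intro face_of_Inter)
        (auto intro!: face_of_refl face_of_Int_supporting_hyperplane_ge)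
    have F: "p \<in> F \<longleftrightarrow> p \<in> P \<and> (\<forall>a\<in>Y. N a \<bullet> p = N a \<bullet> v)" for p by (auto simp: F_def)
    have "v + t *\<^sub>R z \<in> F" using t Nz by (simp add: F inner_add_right)
    then have "F \<noteq> {v}" using t z0 by auto
    moreover have "v extreme_point_of F" using extreme_point_of_face[OF FP] v vP by (auto simp: F)
    ultimately obtain w where w: "w \<noteq> v" "closed_segment v w face_of F"
      using polytope_edge_at_vertex face_of_polytope_polytope[OF polytope_P FP] by metis
    then have "closed_segment v w face_of P" using FP face_of_trans by blast
    then have "w - v \<in> Y" using w by (auto simp: Y_def)
    moreover have "w \<in> F" using face_of_imp_subset[OF w(2)] by auto
    ultimately show False using Naa[of "w - v"] by (auto simp: F inner_diff_right)
  qed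
  have span: "y \<in> span Y" for y
  proof -
    obtain q e where e: "e > 0" "cball q e \<subseteq> P"
      using interior_P mem_interior_cball[of _ P] by blast
    define t where "t = e / (norm y + 1)"
    have t: "t > 0" using e by (simp add: t_def add_nonneg_pos)
    have "t * norm y \<le> e"
    proof -
      have "t * norm y \<le> t * (norm y + 1)" using t by simp
      also have "\<dots> = e" using norm_ge_zero[of y] by (simp add: t_def add_nonneg_pos del: norm_ge_zero)
      finally show ?thesis .
    qed
    then have "q + t *\<^sub>R y \<in> P" "q \<in> P" using e t by (auto intro!: subsetD[OF e(2)] simp: dist_norm)
    then have "feasible P v (q + t *\<^sub>R y - v)" "feasible P v (q - v)"
      by (auto intro: feasible_toward)
    moreover have "z \<in> span Y" if "feasible P v z" for z
      by (subst frep[OF that]) (intro span_sum span_scale span_base)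
    ultimately have "q + t *\<^sub>R y - v \<in> span Y" "q - v \<in> span Y" by blast+
    then have "(q + t *\<^sub>R y - v) - (q - v) \<in> span Y" by (rule span_diff)
    then have "t *\<^sub>R y \<in> span Y" by simp
    then have "(1 / t) *\<^sub>R (t *\<^sub>R y) \<in> span Y" by (rule span_scale)
    then show ?thesis using t by simp
  qed
  have rep: "y = (\<Sum>a\<in>Y. (N a \<bullet> y) *\<^sub>R a)" for y
  proof -
    obtain u where u: "y = (\<Sum>a\<in>Y. u a *\<^sub>R a)" using span[of y] span_finite[OF fin] by auto
    then have "N a \<bullet> y = u a" if "a \<in> Y" for a using Nsum[OF that] by simp
    then show ?thesis using u by simp
  qed
  have cone: "feasible P v y \<longleftrightarrow> (\<forall>a\<in>Y. N a \<bullet> y \<ge> 0)" for y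
  proof
    assume "\<forall>a\<in>Y. N a \<bullet> y \<ge> 0"
    then have "feasible P v (\<Sum>a\<in>Y. (N a \<bullet> y) *\<^sub>R a)"
      using fin Yf vP convex_P by (intro feasible_sum feasible_scale) auto
    then show "feasible P v y" using rep[of y] by simp
  qed (use Nf in blast)
  have "card Y = DIM('a)"
    using basis_card_eq_dim[of Y UNIV] span ind by auto
  from that[OF fin ind this Naa Nab rep edge(1) NP cone] show ?thesis .
qed

section \<open>The body is a box\<close>

text \<open>A walk along the edges of the box spanned by the edges at \<open>v\<close>, adding one edge vector at a time.
The cone at the corner \<open>v + \<Sum>S\<close> is the orthant with the signs of the directions in \<open>S\<close>
reversed; carrying this along in the induction tells at each corner which edges leave it.\<close>

lemma corners_of_box:
  assumes fin: "finite Y"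
    and Naa: "\<And>a. a \<in> Y \<Longrightarrow> N a \<bullet> a = (1::real)"
    and Nab: "\<And>a b. a \<in> Y \<Longrightarrow> b \<in> Y \<Longrightarrow> a \<noteq> b \<Longrightarrow> N a \<bullet> b = 0"
    and rep: "\<And>y. y = (\<Sum>a\<in>Y. (N a \<bullet> y) *\<^sub>R a)"
    and top: "\<And>a. a \<in> Y \<Longrightarrow> v + a \<in> P" and vP: "v \<in> P"
    and NP: "\<And>a p. a \<in> Y \<Longrightarrow> p \<in> P \<Longrightarrow> N a \<bullet> v \<le> N a \<bullet> p \<and> N a \<bullet> p \<le> N a \<bullet> v + 1"
    and cone: "\<And>y. feasible P v y \<longleftrightarrow> (\<forall>a\<in>Y. N a \<bullet> y \<ge> 0)"
    and S: "S \<subseteq> Y"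
  shows "v + \<Sum>S \<in> P \<and>
    (\<forall>y. feasible P (v + \<Sum>S) y \<longleftrightarrow> (\<forall>a\<in>Y. (if a \<in> S then - 1 else 1) * (N a \<bullet> y) \<ge> 0))"
  using finite_subset[OF S fin] S
proof (induction S)
  case empty
  then show ?case using vP cone by simp
next
  case (insert b S)
  have b: "b \<in> Y" "b \<notin> S" and SY: "S \<subseteq> Y" and finS: "finite S" using insert by auto
  define p where "p = v + \<Sum>S"
  define sg :: "'a \<Rightarrow> real" where "sg a = (if a \<in> S then - 1 else 1)" for a
  have pP: "p \<in> P" and cp: "\<And>y. feasible P p y \<longleftrightarrow> (\<forall>a\<in>Y. sg a * (N a \<bullet> y) \<ge> 0)"
    using insert.IH[OF SY] by (auto simp: p_def sg_def)
  have NS: "N a \<bullet> p = N a \<bullet> v + (if a \<in> S then 1 else 0)" if "a \<in> Y" for a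
  proof -
    have "N a \<bullet> \<Sum>S = (\<Sum>c\<in>S. if c = a then 1 else 0)"
      unfolding inner_sum_right using that SY Naa Nab by (intro sum.cong) auto
    then show ?thesis using finS by (simp add: p_def inner_add_right)
  qed
  \<comment> \<open>All coordinates in \<open>T\<close> are extreme at \<open>p\<close>, so \<open>G T\<close> is a face of \<open>P\<close>. For
    \<open>T = Y - {b}\<close> it lies on the line through \<open>p\<close> with direction \<open>b\<close>.\<close>
  define G where "G T = \<Inter>(insert P ((\<lambda>a. P \<inter> {q. N a \<bullet> q = N a \<bullet> p}) ` T))" for T
  have GP: "G T face_of P" if "T \<subseteq> Y" for T
  proof -
    have "P \<inter> {q. N a \<bullet> q = N a \<bullet> p} face_of P" if "a \<in> Y" for a
    proof (cases "a \<in> S")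
      case True
      then show ?thesis using NP[OF that] NS[OF that] convex_P
        by (intro face_of_Int_supporting_hyperplane_le) auto
    next
      case False
      then show ?thesis using NP[OF that] NS[OF that] convex_P
        by (intro face_of_Int_supporting_hyperplane_ge) auto
    qed
    then show ?thesis unfolding G_def using that convex_P
      by (intro face_of_Inter) (auto intro: face_of_refl)
  qed
  have G: "q \<in> G T \<longleftrightarrow> q \<in> P \<and> (\<forall>a\<in>T. N a \<bullet> q = N a \<bullet> p)" for q T by (auto simp: G_def)
  have "q = p" if "q \<in> G Y" for q
  proof -
    have "q - p = (\<Sum>a\<in>Y. (N a \<bullet> (q - p)) *\<^sub>R a)" by (rule rep)
    also have "\<dots> = 0" using that by (intro sum.neutral) (auto simp: G inner_diff_right)
    finally show ?thesis by simp
  qed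
  then have "G Y = {p}" using pP by (auto simp: G)
  then have pext: "p extreme_point_of P" using GP[of Y] by (simp add: face_of_singleton)
  let ?L = "G (Y - {b})"
  have Lf: "?L face_of P" by (rule GP) auto
  have Lb: "q = p + (N b \<bullet> (q - p)) *\<^sub>R b" if "q \<in> ?L" for q
  proof -
    have "q - p = (\<Sum>a\<in>Y. (N a \<bullet> (q - p)) *\<^sub>R a)" by (rule rep)
    also have "\<dots> = (N b \<bullet> (q - p)) *\<^sub>R b + (\<Sum>a\<in>Y - {b}. (N a \<bullet> (q - p)) *\<^sub>R a)"
      using fin b by (intro sum.remove)
    also have "(\<Sum>a\<in>Y - {b}. (N a \<bullet> (q - p)) *\<^sub>R a) = 0"
      using that by (intro sum.neutral) (auto simp: G inner_diff_right)
    finally show ?thesis by (simp add: algebra_simps)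
  qed
  have Nb: "N a \<bullet> b = (if a = b then 1 else 0)" if "a \<in> Y" for a
    using Naa Nab b(1) that by auto
  have "feasible P p b" unfolding cp using Nb b by (auto simp: sg_def)
  then obtain t0 where t0: "t0 > 0" "p + t0 *\<^sub>R b \<in> P" by (auto simp: feasible_def)
  have "p + t0 *\<^sub>R b \<in> ?L" using t0 Nab b by (auto simp: G inner_add_right)
  moreover have "b \<noteq> 0" using Naa[OF b(1)] by auto
  ultimately have "?L \<noteq> {p}" using t0 by auto
  moreover have "p extreme_point_of ?L"
    using extreme_point_of_face[OF Lf] pext pP by (auto simp: G)
  ultimately obtain w where w: "w \<noteq> p" "closed_segment p w face_of ?L"
    using polytope_edge_at_vertex face_of_polytope_polytope[OF polytope_P Lf] by metis
  have wL: "w \<in> ?L" using face_of_imp_subset[OF w(2)] by auto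
  then have wP: "w \<in> P" by (simp add: G)
  define t where "t = N b \<bullet> (w - p)"
  have wt: "w = p + t *\<^sub>R b" using Lb[OF wL] by (simp add: t_def)
  have "N b \<bullet> w \<ge> N b \<bullet> p" using NP[OF b(1) wP] NS[OF b(1)] b by simp
  then have "t \<ge> 0" by (simp add: t_def inner_diff_right)
  moreover have "t \<noteq> 0" using w(1) wt by auto
  ultimately have t: "t > 0" by simp
  have Ew: "closed_segment p w face_of P" "p \<noteq> w" using face_of_trans[OF w(2) Lf] w by auto
  obtain n where n: "n \<bullet> (w - p) = 1" "\<And>q. q \<in> P \<Longrightarrow> n \<bullet> p \<le> n \<bullet> q \<and> n \<bullet> q \<le> n \<bullet> w"
    and nsplit: "\<And>y. feasible P p y \<or> feasible P w y \<Longrightarrow>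
       feasible P p (y - (n \<bullet> y) *\<^sub>R (w - p)) \<and> feasible P w (y - (n \<bullet> y) *\<^sub>R (w - p))"
    using edge_splits_feasible_cones[OF Ew] by metis
  \<comment> \<open>The new edge has a width functional of its own. The splitting of the orthant at \<open>p\<close> forces it
    to be a multiple of \<open>N b\<close>, so the slab of \<open>P\<close> has the same width along the new edge as along
    the edge \<open>b\<close> at \<open>v\<close>, and the new edge is exactly \<open>b\<close>.\<close>
  have nb: "t * (n \<bullet> b) = 1" using n(1) wt by simp
  have na: "n \<bullet> a = 0" if a: "a \<in> Y" "a \<noteq> b" for a
  proof -
    define y where "y = sg a *\<^sub>R a"
    have Ny: "N c \<bullet> y = (if c = a then sg a else 0)" if "c \<in> Y" for c
      using that a Naa Nab by (simp add: y_def)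
    have fy: "feasible P p y" unfolding cp using Ny by (auto simp: sg_def)
    have "feasible P p (y - (n \<bullet> y) *\<^sub>R (w - p))" using nsplit fy by blast
    then have "sg b * (N b \<bullet> (y - (n \<bullet> y) *\<^sub>R (w - p))) \<ge> 0" using cp b by blast
    then have "(n \<bullet> y) * t \<le> 0" using b Ny[OF b(1)] a Naa[OF b(1)] wt by (simp add: sg_def inner_diff_right)
    then have "n \<bullet> y \<le> 0" using t by (simp add: mult_le_0_iff)
    moreover obtain s where s: "s > 0" "p + s *\<^sub>R y \<in> P" using fy by (auto simp: feasible_def)
    then have "0 \<le> s * (n \<bullet> y)" using n(2)[OF s(2)] by (simp add: inner_add_right)
    then have "n \<bullet> y \<ge> 0" using s by (simp add: zero_le_mult_iff)
    ultimately show ?thesis by (simp add: y_def sg_def split: if_splits)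
  qed
  have nN: "t * (n \<bullet> z) = N b \<bullet> z" for z
  proof -
    have "n \<bullet> z = n \<bullet> (\<Sum>a\<in>Y. (N a \<bullet> z) *\<^sub>R a)" using rep[of z] by simp
    also have "\<dots> = (\<Sum>a\<in>Y. if a = b then (N b \<bullet> z) * (n \<bullet> b) else 0)"
      unfolding inner_sum_right using na by (intro sum.cong) auto
    also have "\<dots> = (N b \<bullet> z) * (n \<bullet> b)" using fin b by simp
    finally show ?thesis using nb by (simp add: mult.left_commute mult.commute)
  qed
  have "t * (n \<bullet> (v + b)) \<le> t * (n \<bullet> w)" using n(2)[OF top[OF b(1)]] t by simp
  then have "1 \<le> t" unfolding nN
    using wt NS[OF b(1)] b Naa[OF b(1)] by (simp add: inner_add_right)
  moreover have "t \<le> 1" using NP[OF b(1) wP] wt NS[OF b(1)] b Naa[OF b(1)] by (simp add: inner_add_right)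
  ultimately have t1: "t = 1" by simp
  have wb: "w = p + b" using wt t1 by simp
  have nNb: "n \<bullet> z = N b \<bullet> z" for z using nN[of z] t1 by simp
  have wS: "w = v + \<Sum>(insert b S)" using finS b by (simp add: wb p_def algebra_simps)
  have "feasible P w y \<longleftrightarrow> (\<forall>a\<in>Y. (if a \<in> insert b S then - 1 else 1) * (N a \<bullet> y) \<ge> 0)" for y
  proof -
    define h where "h = y - (N b \<bullet> y) *\<^sub>R b"
    have Nh: "N a \<bullet> h = (if a = b then 0 else N a \<bullet> y)" if "a \<in> Y" for a
      using that Naa Nab b by (simp add: h_def inner_diff_right)
    have hp: "feasible P p h \<longleftrightarrow> (\<forall>a\<in>Y - {b}. sg a * (N a \<bullet> y) \<ge> 0)"
      unfolding cp using Nh by auto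
    have "feasible P w y \<longleftrightarrow> feasible P p h \<and> N b \<bullet> y \<le> 0"
    proof
      assume fy: "feasible P w y"
      then have "feasible P p h" using nsplit[of y] by (simp add: h_def nNb wb)
      moreover obtain s where s: "s > 0" "w + s *\<^sub>R y \<in> P" using fy by (auto simp: feasible_def)
      then have "s * (N b \<bullet> y) \<le> 0" using n(2)[OF s(2)] by (simp add: inner_add_right nNb)
      then have "N b \<bullet> y \<le> 0" using s by (simp add: mult_le_0_iff)
      ultimately show "feasible P p h \<and> N b \<bullet> y \<le> 0" by simp
    next
      assume R: "feasible P p h \<and> N b \<bullet> y \<le> 0"
      then have "feasible P w h" using nsplit[of h] Nh[OF b(1)] by (simp add: nNb)
      moreover have "feasible P w ((- (N b \<bullet> y)) *\<^sub>R (- b))"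
        using feasible_toward[OF pP, of w] R wP by (intro feasible_scale) (auto simp: wb)
      ultimately have "feasible P w (h + (- (N b \<bullet> y)) *\<^sub>R (- b))"
        using feasible_add convex_P wP by blast
      then show "feasible P w y" by (simp add: h_def)
    qed
    then show ?thesis unfolding hp using b by (auto simp: sg_def)
  qed
  then show ?case using wP wS by simp
qed

lemma self_tiled_body_is_box:
  assumes v: "v extreme_point_of P"
  obtains Y N where "finite Y" "independent Y" "card Y = DIM('a)"
    "\<And>a. a \<in> Y \<Longrightarrow> N a \<bullet> a = (1::real)" "\<And>a b. a \<in> Y \<Longrightarrow> b \<in> Y \<Longrightarrow> a \<noteq> b \<Longrightarrow> N a \<bullet> b = 0"
    "\<And>y. y = (\<Sum>a\<in>Y. (N a \<bullet> y) *\<^sub>R a)"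
    "\<And>a. a \<in> Y \<Longrightarrow> v + (1/2) *\<^sub>R a \<in> X"
    "\<And>p. p \<in> P \<longleftrightarrow> (\<forall>a\<in>Y. N a \<bullet> v \<le> N a \<bullet> p \<and> N a \<bullet> p \<le> N a \<bullet> v + 1)"
proof -
  have vP: "v \<in> P" using v by (simp add: extreme_point_of_def)
  obtain Y N where fin: "finite Y" and ind: "independent Y" and card: "card Y = DIM('a)"
    and Naa: "\<And>a. a \<in> Y \<Longrightarrow> N a \<bullet> a = (1::real)"
    and Nab: "\<And>a b. a \<in> Y \<Longrightarrow> b \<in> Y \<Longrightarrow> a \<noteq> b \<Longrightarrow> N a \<bullet> b = 0"
    and rep: "\<And>y. y = (\<Sum>a\<in>Y. (N a \<bullet> y) *\<^sub>R a)"
    and edge: "\<And>a. a \<in> Y \<Longrightarrow> closed_segment v (v + a) face_of P"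
    and NP: "\<And>a p. a \<in> Y \<Longrightarrow> p \<in> P \<Longrightarrow> N a \<bullet> v \<le> N a \<bullet> p \<and> N a \<bullet> p \<le> N a \<bullet> v + 1"
    and cone: "\<And>y. feasible P v y \<longleftrightarrow> (\<forall>a\<in>Y. N a \<bullet> y \<ge> 0)"
    by (rule edges_at_vertex_form_basis[OF v]) (rule that; assumption)
  have half: "v + (1/2) *\<^sub>R a \<in> X" if "a \<in> Y" for a
  proof -
    have "v \<noteq> v + a" using Naa[OF that] by auto
    then have "midpoint v (v + a) \<in> X" using edge_midpoint_in_X edge[OF that] by blast
    also have "midpoint v (v + a) = v + (1/2) *\<^sub>R a"
      by (simp add: midpoint_def algebra_simps flip: scaleR_add_left)
    finally show ?thesis .
  qed
  have top: "v + a \<in> P" if "a \<in> Y" for a using face_of_imp_subset[OF edge[OF that]] by auto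
  have corner: "v + \<Sum>S \<in> P" if "S \<subseteq> Y" for S
    using corners_of_box[OF fin Naa Nab rep top vP NP cone that] by blast
  \<comment> \<open>Interpolation between corners, one coordinate at a time.\<close>
  have fill: "v + \<Sum>S + (\<Sum>a\<in>T. t a *\<^sub>R a) \<in> P"
    if "finite T" "T \<subseteq> Y" "S \<subseteq> Y - T" "\<And>a. a \<in> T \<Longrightarrow> 0 \<le> t a \<and> t a \<le> 1" for S T t
    using that
  proof (induction T arbitrary: S)
    case empty
    then show ?case using corner by simp
  next
    case (insert b T)
    have "v + \<Sum>S + (\<Sum>a\<in>T. t a *\<^sub>R a) \<in> P" using insert.prems by (intro insert.IH) auto
    moreover have "v + \<Sum>(insert b S) + (\<Sum>a\<in>T. t a *\<^sub>R a) \<in> P"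
      using insert.prems insert.hyps by (intro insert.IH) auto
    ultimately have "(1 - t b) *\<^sub>R (v + \<Sum>S + (\<Sum>a\<in>T. t a *\<^sub>R a)) +
        t b *\<^sub>R (v + \<Sum>(insert b S) + (\<Sum>a\<in>T. t a *\<^sub>R a)) \<in> P"
      using insert.prems(3)[of b] convex_P by (intro convexD) auto
    moreover have "finite S" "b \<notin> S" using insert.prems(2) finite_subset[of S Y] fin by auto
    ultimately show ?case using insert.hyps by (simp add: algebra_simps)
  qed
  have box: "p \<in> P \<longleftrightarrow> (\<forall>a\<in>Y. N a \<bullet> v \<le> N a \<bullet> p \<and> N a \<bullet> p \<le> N a \<bullet> v + 1)" for p
  proof
    assume R: "\<forall>a\<in>Y. N a \<bullet> v \<le> N a \<bullet> p \<and> N a \<bullet> p \<le> N a \<bullet> v + 1"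
    have "v + \<Sum>{} + (\<Sum>a\<in>Y. (N a \<bullet> (p - v)) *\<^sub>R a) \<in> P"
      using fin R by (intro fill) (auto simp: inner_diff_right)
    then show "p \<in> P" using rep[of "p - v"] by simp
  qed (use NP in blast)
  from that[OF fin ind card Naa Nab rep half box] show ?thesis .
qed

end

section \<open>Spread sets of translation vectors\<close>

text \<open>The vectors of a pairwise intersecting Minkowski arrangement of translates of the origin-symmetric
body \<open>L\<close>: in the norm with unit ball \<open>L\<close>, all distances lie between 1 and 2.\<close>

definition spread :: "'a::euclidean_space set \<Rightarrow> 'a set \<Rightarrow> bool" where
  "spread L V \<longleftrightarrow>
     (\<forall>v\<in>V. \<forall>w\<in>V. v \<noteq> w \<longrightarrow> (1/2) *\<^sub>R (v - w) \<in> L \<and> v - w \<notin> interior L)"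

locale symmetric_body =
  fixes L :: "'a::euclidean_space set"
  assumes compact_L: "compact L" and convex_L: "convex L" and zero_in_L: "0 \<in> interior L"
    and minus_L: "z \<in> L \<Longrightarrow> - z \<in> L"
begin

lemma spread_set_hull:
  assumes "spread L V" "finite V" "V \<noteq> {}"
  obtains Q where "V \<subseteq> Q" "compact Q" "convex Q" "interior Q \<noteq> {}"
    "\<And>z. z \<in> difference_body Q \<Longrightarrow> (1/2) *\<^sub>R z \<in> L"
    "\<And>x y. x \<in> V \<Longrightarrow> y \<in> V \<Longrightarrow> x \<noteq> y \<Longrightarrow> 2 *\<^sub>R (x - y) \<notin> interior (difference_body Q)"
proof -
  define M where "M = (\<lambda>z. 2 *\<^sub>R z) ` L"
  have M: "z \<in> M \<longleftrightarrow> (1/2) *\<^sub>R z \<in> L" for z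
    unfolding M_def by (auto simp: image_iff intro!: bexI[of _ "(1/2) *\<^sub>R z"])
  have "open ((\<lambda>z. 2 *\<^sub>R z) ` interior L)" by (intro open_scaling) auto
  moreover have "(\<lambda>z. 2 *\<^sub>R z) ` interior L \<subseteq> M" using interior_subset by (auto simp: M_def)
  ultimately have "(\<lambda>z. 2 *\<^sub>R z) ` interior L \<subseteq> interior M" by (simp add: interior_maximal)
  then have "0 \<in> interior M" using zero_in_L by force
  moreover have "convex M" using convex_L by (simp add: M_def convex_scaling)
  moreover have "x - y \<in> M" if "x \<in> V" "y \<in> V" for x y
    using assms(1) that zero_in_L interior_subset[of L] by (cases "x = y") (auto simp: M spread_def)
  ultimately obtain Q where Q: "V \<subseteq> Q" "compact Q" "convex Q" "interior Q \<noteq> {}" "difference_body Q \<subseteq> M"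
    using full_dimensional_hull[OF assms(2,3), of M] minus_L by (auto simp: M)
  have "2 *\<^sub>R (x - y) \<notin> interior (difference_body Q)" if "x \<in> V" "y \<in> V" "x \<noteq> y" for x y
  proof
    assume "2 *\<^sub>R (x - y) \<in> interior (difference_body Q)"
    then have "(1/2) *\<^sub>R (2 *\<^sub>R (x - y)) \<in> (\<lambda>z. (1/2) *\<^sub>R z) ` interior (difference_body Q)" by blast
    moreover have "open ((\<lambda>z. (1/2) *\<^sub>R z) ` interior (difference_body Q))" by (intro open_scaling) auto
    moreover have "(\<lambda>z. (1/2) *\<^sub>R z) ` interior (difference_body Q) \<subseteq> L"
      using Q(5) interior_subset by (fastforce simp: M)
    ultimately have "x - y \<in> interior L" by (auto intro: interiorI)
    then show False using assms(1) that by (auto simp: spread_def)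
  qed
  moreover have "(1/2) *\<^sub>R z \<in> L" if "z \<in> difference_body Q" for z
    using Q(5) that M by blast
  ultimately show ?thesis using that[OF Q(1-4)] by metis
qed

lemma finite_spread_card:
  assumes "spread L V" "finite V"
  shows "card V \<le> 3 ^ DIM('a)"
proof (cases "V = {}")
  case False
  obtain Q where "V \<subseteq> Q" "compact Q" "convex Q" "interior Q \<noteq> {}"
    "\<And>x y. x \<in> V \<Longrightarrow> y \<in> V \<Longrightarrow> x \<noteq> y \<Longrightarrow> 2 *\<^sub>R (x - y) \<notin> interior (difference_body Q)"
    using spread_set_hull[OF assms False] by metis
  then show ?thesis using tripled_body_packing(1)[of Q V] assms(2) by blast
qed simp

lemma spread_card:
  assumes "spread L V"
  shows "finite V \<and> card V \<le> 3 ^ DIM('a)"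
proof (rule finite_if_finite_subsets_card_bdd)
  fix G assume "G \<subseteq> V" "finite G"
  then show "card G \<le> 3 ^ DIM('a)" using assms finite_spread_card[of G] by (auto simp: spread_def)
qed

text \<open>A point of \<open>L\<close> beyond the facet \<open>N a = 1/2\<close> of the box sees the whole relative interior of
that facet from outside, so the facet center \<open>a / 2\<close> becomes an interior point of \<open>L\<close>.\<close>

lemma outside_point_pulls_midpoint_inside:
  assumes fin: "finite Y" and a: "a \<in> Y"
    and Naa: "N a \<bullet> a = (1::real)" and Nab: "\<And>b. b \<in> Y \<Longrightarrow> b \<noteq> a \<Longrightarrow> N b \<bullet> a = 0"
    and box: "\<And>y. \<forall>b\<in>Y. \<bar>N b \<bullet> y\<bar> \<le> 1/2 \<Longrightarrow> y \<in> L"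
    and y: "y \<in> L" "N a \<bullet> y > 1/2"
  shows "(1/2) *\<^sub>R a \<in> interior L"
proof -
  define U where "U = (\<Inter>b\<in>Y. {z. \<bar>N b \<bullet> z\<bar> < 1/2})"
  have "open U" unfolding U_def
    using fin by (intro open_INT) (auto intro!: open_Collect_less continuous_intros)
  moreover have "U \<subseteq> L" using box by (force simp: U_def)
  ultimately have UL: "U \<subseteq> interior L" by (simp add: interior_maximal)
  \<comment> \<open>The center \<open>a / 2\<close> is written as \<open>(1 - l) z + l y\<close>; the weight \<open>l\<close> has to be small
    enough for \<open>z\<close> to stay inside the box although \<open>y\<close> may be far out.\<close>
  define M where "M = (\<Sum>b\<in>Y. \<bar>N b \<bullet> y\<bar>) + 1"
  have M: "M \<ge> 1" "\<bar>N b \<bullet> y\<bar> \<le> M" if "b \<in> Y" for b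
    using member_le_sum[of b Y "\<lambda>b. \<bar>N b \<bullet> y\<bar>"] that fin by (auto simp: M_def sum_nonneg)
  have M1: "M \<ge> 1" using M(1) a by blast
  define l where "l = 1 / (4 * M)"
  have l: "0 < l" "l \<le> 1/4" using M1 by (auto simp: l_def field_simps)
  have lM: "l * \<bar>N b \<bullet> y\<bar> \<le> 1/4" if "b \<in> Y" for b
    using M(2)[OF that] M1 by (simp add: l_def field_simps)
  define z where "z = (1 / (1 - l)) *\<^sub>R ((1/2) *\<^sub>R a - l *\<^sub>R y)"
  have Nz: "N b \<bullet> z = ((1/2) * (N b \<bullet> a) - l * (N b \<bullet> y)) / (1 - l)" for b
    by (simp add: z_def inner_diff_right)
  have "\<bar>N b \<bullet> z\<bar> < 1/2" if b: "b \<in> Y" for b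
  proof (cases "b = a")
    case True
    have "l * (1/2) < l * (N a \<bullet> y)" using y(2) l by simp
    moreover have "l * (N a \<bullet> y) \<le> 1/4" using lM[OF a] y(2) by simp
    ultimately have "\<bar>(1/2) * 1 - l * (N a \<bullet> y)\<bar> < (1 - l) / 2" using l by (simp add: abs_less_iff)
    then show ?thesis unfolding Nz True Naa using l by (simp add: pos_divide_less_eq)
  next
    case False
    have "\<bar>l * (N b \<bullet> y)\<bar> \<le> 1/4" using lM[OF b] l by (simp add: abs_mult)
    then have "\<bar>(1/2) * 0 - l * (N b \<bullet> y)\<bar> < (1 - l) / 2" using l by simp
    then show ?thesis unfolding Nz Nab[OF b False] using l by (simp add: pos_divide_less_eq)
  qed
  then have zi: "z \<in> interior L" using UL by (auto simp: U_def)
  have "y - (1 - l) *\<^sub>R (y - z) \<in> interior L"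
    using l by (intro mem_interior_convex_shrink[OF convex_L zi y(1)]) auto
  also have "y - (1 - l) *\<^sub>R (y - z) = l *\<^sub>R y + (1 - l) *\<^sub>R z" by (simp add: algebra_simps)
  also have "\<dots> = (1/2) *\<^sub>R a" using l by (simp add: z_def)
  finally show ?thesis .
qed

text \<open>The hull of an extremal spread set is a box \<open>Q\<close> with a corner \<open>v\<close> in the set, and the centered
box \<open>(Q - Q) / 2\<close> is contained in \<open>L\<close>. Conversely, \<open>L\<close> cannot stick out of it: the half
edge \<open>a / 2\<close> would become interior to \<open>L\<close>, but it is the difference of two elements of the set,
the midpoint of an edge and \<open>v\<close>.\<close>

lemma extremal_spread_set_box:
  assumes sp: "spread L V" and card: "card V = 3 ^ DIM('a)"
  obtains Y N where "finite Y" "independent Y" "card Y = DIM('a)"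
    "\<And>a. a \<in> Y \<Longrightarrow> N a \<bullet> a = (1::real)" "\<And>a b. a \<in> Y \<Longrightarrow> b \<in> Y \<Longrightarrow> a \<noteq> b \<Longrightarrow> N a \<bullet> b = 0"
    "\<And>y. y = (\<Sum>a\<in>Y. (N a \<bullet> y) *\<^sub>R a)"
    "\<And>y. y \<in> L \<longleftrightarrow> (\<forall>a\<in>Y. \<bar>N a \<bullet> y\<bar> \<le> 1/2)"
proof -
  have "card V > 0" unfolding card by simp
  then have finV: "finite V" and V0: "V \<noteq> {}" using card_gt_0_iff by blast+
  obtain Q where Q: "V \<subseteq> Q" "compact Q" "convex Q" "interior Q \<noteq> {}"
    and QL: "\<And>z. z \<in> difference_body Q \<Longrightarrow> (1/2) *\<^sub>R z \<in> L"
    and packed: "\<And>x y. x \<in> V \<Longrightarrow> y \<in> V \<Longrightarrow> x \<noteq> y \<Longrightarrow> 2 *\<^sub>R (x - y) \<notin> interior (difference_body Q)"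
    using spread_set_hull[OF sp finV V0] by metis
  have cover: "\<exists>x\<in>V. \<exists>p\<in>Q. 3 *\<^sub>R y = 2 *\<^sub>R x + p" if "y \<in> Q" for y
    using tripled_body_packing(2)[OF Q(2-4) finV Q(1) packed card that] .
  have ext: "e \<in> V" if e: "e extreme_point_of Q" for e
  proof -
    obtain x p where x: "x \<in> V" "p \<in> Q" "3 *\<^sub>R e = 2 *\<^sub>R x + p"
      using cover[of e] e unfolding extreme_point_of_def by blast
    have "e = (1/3) *\<^sub>R (3 *\<^sub>R e)" by simp
    also have "\<dots> = (1 - 1/3) *\<^sub>R x + (1/3) *\<^sub>R p" unfolding x(3) by (simp add: algebra_simps)
    finally have ee: "e = (1 - 1/3) *\<^sub>R x + (1/3) *\<^sub>R p" .
    have "x = p"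
    proof (rule ccontr)
      assume "x \<noteq> p"
      then have "e \<in> open_segment x p" unfolding in_segment using ee by (auto intro!: exI[of _ "1/3"])
      then show False using e x Q(1) by (auto simp: extreme_point_of_def)
    qed
    then have "e = x" using ee by (simp flip: scaleR_add_left)
    then show ?thesis using x by simp
  qed
  have KM: "Q = convex hull {e. e extreme_point_of Q}" using Krein_Milman_Minkowski Q by blast
  have "Q \<noteq> {}" using Q(4) by auto
  then obtain v where v: "v extreme_point_of Q" using KM by (metis convex_hull_eq_empty empty_Collect_eq)
  have "convex hull {e. e extreme_point_of Q} \<subseteq> convex hull V" using ext by (intro hull_mono) auto
  moreover have "convex hull V \<subseteq> Q" using Q by (simp add: hull_minimal)
  ultimately have "Q = convex hull V" using KM by blast
  then interpret self_tiling V Q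
    using finV Q cover packed by unfold_locales
  obtain Y N where fin: "finite Y" and ind: "independent Y" and cardY: "card Y = DIM('a)"
    and Naa: "\<And>a. a \<in> Y \<Longrightarrow> N a \<bullet> a = (1::real)"
    and Nab: "\<And>a b. a \<in> Y \<Longrightarrow> b \<in> Y \<Longrightarrow> a \<noteq> b \<Longrightarrow> N a \<bullet> b = 0"
    and rep: "\<And>y. y = (\<Sum>a\<in>Y. (N a \<bullet> y) *\<^sub>R a)"
    and half: "\<And>a. a \<in> Y \<Longrightarrow> v + (1/2) *\<^sub>R a \<in> V"
    and boxQ: "\<And>p. p \<in> Q \<longleftrightarrow> (\<forall>a\<in>Y. N a \<bullet> v \<le> N a \<bullet> p \<and> N a \<bullet> p \<le> N a \<bullet> v + 1)"
    by (rule self_tiled_body_is_box[OF v]) (rule that; assumption)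
  have Nval: "N b \<bullet> a = (if a = b then 1 else 0)" if "a \<in> Y" "b \<in> Y" for a b
    using that Naa Nab by auto
  have Nsum: "N b \<bullet> (\<Sum>a\<in>Y. u a *\<^sub>R a) = u b" if "b \<in> Y" for b u
  proof -
    have "N b \<bullet> (\<Sum>a\<in>Y. u a *\<^sub>R a) = (\<Sum>a\<in>Y. if a = b then u b else 0)"
      unfolding inner_sum_right using that Nval by (intro sum.cong) auto
    then show ?thesis using that fin by auto
  qed
  have inL: "y \<in> L" if y: "\<forall>a\<in>Y. \<bar>N a \<bullet> y\<bar> \<le> 1/2" for y
  proof -
    define p where "p = v + (\<Sum>a\<in>Y. (1/2 + N a \<bullet> y) *\<^sub>R a)"
    define q where "q = v + (\<Sum>a\<in>Y. (1/2 - N a \<bullet> y) *\<^sub>R a)"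
    have "p \<in> Q" unfolding boxQ p_def using y by (auto simp: inner_add_right Nsum abs_le_iff)
    moreover have "q \<in> Q" unfolding boxQ q_def using y by (auto simp: inner_add_right Nsum abs_le_iff)
    ultimately have "(1/2) *\<^sub>R (p - q) \<in> L" by (intro QL difference_bodyI)
    also have "p - q = (\<Sum>a\<in>Y. 2 *\<^sub>R ((N a \<bullet> y) *\<^sub>R a))"
    proof -
      have "p - q = (\<Sum>a\<in>Y. (1/2 + N a \<bullet> y) *\<^sub>R a - (1/2 - N a \<bullet> y) *\<^sub>R a)"
        by (simp add: p_def q_def sum_subtractf)
      also have "\<dots> = (\<Sum>a\<in>Y. 2 *\<^sub>R ((N a \<bullet> y) *\<^sub>R a))"
        by (intro sum.cong refl) (simp flip: scaleR_left_diff_distrib)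
      finally show ?thesis .
    qed
    also have "\<dots> = 2 *\<^sub>R (\<Sum>a\<in>Y. (N a \<bullet> y) *\<^sub>R a)" by (simp only: scaleR_sum_right)
    also have "(\<Sum>a\<in>Y. (N a \<bullet> y) *\<^sub>R a) = y" by (rule rep[symmetric])
    finally show ?thesis by simp
  qed
  have vV: "v \<in> V" using ext v by blast
  have notint: "(1/2) *\<^sub>R a \<notin> interior L" if "a \<in> Y" for a
  proof -
    have "v + (1/2) *\<^sub>R a \<noteq> v" using Naa[OF that] by auto
    then have "(v + (1/2) *\<^sub>R a) - v \<notin> interior L"
      using sp half[OF that] vV unfolding spread_def by blast
    then show ?thesis by simp
  qed
  have upper: "N a \<bullet> y \<le> 1/2" if "a \<in> Y" "y \<in> L" for a y
  proof (rule ccontr)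
    assume "\<not> N a \<bullet> y \<le> 1/2"
    then have "N a \<bullet> y > 1/2" by simp
    then have "(1/2) *\<^sub>R a \<in> interior L"
      using that by (intro outside_point_pulls_midpoint_inside[OF fin, where N = N and y = y])
        (auto intro: Naa Nab inL)
    then show False using notint[OF that(1)] by simp
  qed
  have boxL: "y \<in> L \<longleftrightarrow> (\<forall>a\<in>Y. \<bar>N a \<bullet> y\<bar> \<le> 1/2)" for y
  proof
    assume y: "y \<in> L"
    have "N a \<bullet> y \<le> 1/2" "N a \<bullet> (- y) \<le> 1/2" if "a \<in> Y" for a
      using upper[OF that y] upper[OF that minus_L[OF y]] by auto
    then show "\<forall>a\<in>Y. \<bar>N a \<bullet> y\<bar> \<le> 1/2" by (simp only: abs_le_iff inner_minus_right) blast
  qed (rule inL)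
  from that[OF fin ind cardY Naa Nab rep boxL] show ?thesis .
qed

end

section \<open>Boxes admit extremal sets\<close>

lemma independent_coefficients_unique:
  fixes B :: "'a::euclidean_space set"
  assumes "independent B" "(\<Sum>b\<in>B. s b *\<^sub>R b) = (\<Sum>b\<in>B. t b *\<^sub>R b)" "b \<in> B"
  shows "s b = t b"
proof -
  have "(\<Sum>b\<in>B. (s b - t b) *\<^sub>R b) = 0"
    using assms(2) by (simp add: scaleR_left_diff_distrib sum_subtractf)
  then have "s b - t b = 0"
    by (rule independentD[OF assms(1) independent_imp_finite[OF assms(1)] subset_refl _ assms(3)])
  then show ?thesis by simp
qed

text \<open>The grid with coordinates in \<open>{-1/2, 0, 1/2}\<close>: coordinates of two grid points differ by at most
1, and some coordinate differs by at least 1/2.\<close>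

lemma box_has_extremal_spread_set:
  fixes B :: "'a::euclidean_space set"
  assumes B: "independent B" and L: "L = {\<Sum>b\<in>B. s b *\<^sub>R b | s. \<forall>b\<in>B. \<bar>s b\<bar> \<le> 1/2}"
  obtains V where "spread L V" "finite V" "card V = 3 ^ card B"
proof -
  have fin: "finite B" using B independent_imp_finite by blast
  define C where "C = {-1/2, 0, 1/2 :: real}"
  define g where "g s = (\<Sum>b\<in>B. s b *\<^sub>R b)" for s :: "'a \<Rightarrow> real"
  define S where "S = (B \<rightarrow>\<^sub>E C)"
  have S: "s b \<in> C" if "s \<in> S" "b \<in> B" for s b using that by (auto simp: S_def)
  have gdiff: "g s - g t = g (\<lambda>b. s b - t b)" for s t
    by (simp add: g_def scaleR_left_diff_distrib sum_subtractf)
  have gL: "g s \<in> L \<longleftrightarrow> (\<forall>b\<in>B. \<bar>s b\<bar> \<le> 1/2)" for s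
  proof
    assume "g s \<in> L"
    then obtain t where t: "g s = g t" "\<forall>b\<in>B. \<bar>t b\<bar> \<le> 1/2" by (auto simp: L g_def)
    then have "\<forall>b\<in>B. s b = t b" using independent_coefficients_unique[OF B] by (auto simp: g_def)
    then show "\<forall>b\<in>B. \<bar>s b\<bar> \<le> 1/2" using t by auto
  qed (auto simp: L g_def)
  have inj: "inj_on g S"
  proof (rule inj_onI)
    fix s t assume st: "s \<in> S" "t \<in> S" "g s = g t"
    then have "s b = t b" if "b \<in> B" for b
      using independent_coefficients_unique[OF B _ that] by (simp add: g_def)
    then show "s = t" using st unfolding S_def by (intro PiE_ext) auto
  qed
  have "card S = 3 ^ card B"
    using fin by (simp add: S_def card_PiE C_def numeral_3_eq_3)
  then have card: "card (g ` S) = 3 ^ card B" using inj by (simp add: card_image)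
  have finS: "finite (g ` S)" using fin by (simp add: S_def C_def finite_PiE)
  have "spread L (g ` S)"
    unfolding spread_def
  proof (intro ballI impI)
    fix v w assume "v \<in> g ` S" "w \<in> g ` S" "v \<noteq> w"
    then obtain s t where st: "s \<in> S" "t \<in> S" "v = g s" "w = g t" "s \<noteq> t" by auto
    define u where "u b = s b - t b" for b
    have vw: "v - w = g u" unfolding st(3,4) gdiff u_def[abs_def] ..
    have u: "\<bar>u b\<bar> \<le> 1" "u b = 0 \<or> \<bar>u b\<bar> \<ge> 1/2" if "b \<in> B" for b
    proof -
      have "s b = -1/2 \<or> s b = 0 \<or> s b = 1/2" "t b = -1/2 \<or> t b = 0 \<or> t b = 1/2"
        using S[OF st(1) that] S[OF st(2) that] unfolding C_def by blast+
      then show "\<bar>u b\<bar> \<le> 1" "u b = 0 \<or> \<bar>u b\<bar> \<ge> 1/2" unfolding u_def by linarith+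
    qed
    have "(1/2) *\<^sub>R g u = g (\<lambda>b. u b / 2)" by (simp add: g_def scaleR_sum_right)
    moreover have "g (\<lambda>b. u b / 2) \<in> L"
      unfolding gL
    proof
      fix b assume "b \<in> B"
      then show "\<bar>u b / 2\<bar> \<le> 1/2" using u(1)[of b] by linarith
    qed
    ultimately have 1: "(1/2) *\<^sub>R (v - w) \<in> L" unfolding vw by metis
    obtain b where b: "b \<in> B" "s b \<noteq> t b"
      using st unfolding S_def by (metis PiE_ext)
    then have ub: "\<bar>u b\<bar> \<ge> 1/2" using u(2)[OF b(1)] by (auto simp: u_def)
    have "b \<noteq> 0" using B b dependent_zero by blast
    have "v - w \<notin> interior L"
    proof
      assume "v - w \<in> interior L"
      then obtain e where e: "e > 0" "cball (g u) e \<subseteq> L" using vw mem_interior_cball by metis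
      \<comment> \<open>Moving outward in a coordinate of absolute value at least 1/2 leaves the box at once.\<close>
      define d where "d = sgn (u b) * e / norm b"
      define u' where "u' = (\<lambda>c. u c + (if c = b then d else 0))"
      have "g u' = g u + (\<Sum>c\<in>B. (if c = b then d else 0) *\<^sub>R c)"
        by (simp add: g_def u'_def scaleR_left_distrib sum.distrib)
      also have "(\<Sum>c\<in>B. (if c = b then d else 0) *\<^sub>R c) = d *\<^sub>R b"
      proof -
        have "(\<Sum>c\<in>B. (if c = b then d else 0) *\<^sub>R c) = (\<Sum>c\<in>B. if c = b then d *\<^sub>R b else 0)"
          by (intro sum.cong) auto
        then show ?thesis using fin b by simp
      qed
      finally have g': "g u' = g u + d *\<^sub>R b" .
      have "norm (d *\<^sub>R b) \<le> e" using \<open>b \<noteq> 0\<close> e by (simp add: d_def abs_mult sgn_if)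
      then have "g u' \<in> L" using e(2) g' by (auto simp: dist_norm)
      then have "\<bar>u' b\<bar> \<le> 1/2" using gL b by blast
      moreover have "u b \<noteq> 0" using ub by auto
      moreover have "u' b = u b + sgn (u b) * (e / norm b)" by (simp add: u'_def d_def)
      moreover have "\<dots> = sgn (u b) * (\<bar>u b\<bar> + e / norm b)"
        by (simp add: distrib_left sgn_mult_abs)
      moreover have "\<bar>sgn (u b) * (\<bar>u b\<bar> + e / norm b)\<bar> = \<bar>u b\<bar> + e / norm b"
        using \<open>u b \<noteq> 0\<close> e by (simp add: abs_mult abs_sgn_eq)
      ultimately have "\<bar>u b\<bar> + e / norm b \<le> 1/2" by simp
      moreover have "e / norm b > 0" using e \<open>b \<noteq> 0\<close> by simp
      ultimately show False using ub by linarith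
    qed
    then show "(1/2) *\<^sub>R (v - w) \<in> L \<and> v - w \<notin> interior L" using 1 by simp
  qed
  then show ?thesis using finS card by (rule that)
qed

section \<open>Arrangements of translates\<close>

lemma centered_symmetric_body:
  assumes K: "convex_body K" and c: "center_of_symmetry c K"
  shows "symmetric_body ((\<lambda>x. x - c) ` K)"
proof
  have K': "compact K" "convex K" "interior K \<noteq> {}" using K by (auto simp: convex_body_def)
  show "compact ((\<lambda>x. x - c) ` K)" using K' by (simp add: compact_translation_subtract)
  show cL: "convex ((\<lambda>x. x - c) ` K)" using K' by (simp add: convex_translation_subtract)
  have refl: "2 *\<^sub>R c - x \<in> K" if "x \<in> K" for x using c that unfolding center_of_symmetry_def by blast
  show neg: "- z \<in> (\<lambda>x. x - c) ` K" if z: "z \<in> (\<lambda>x. x - c) ` K" for z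
  proof -
    obtain x where "x \<in> K" "z = x - c" using z by auto
    then show ?thesis using refl[of x] by (intro image_eqI[of _ _ "2 *\<^sub>R c - x"]) (auto simp: scaleR_2)
  qed
  obtain q where q: "q \<in> interior K" using K' by blast
  let ?L = "(\<lambda>x. x - c) ` K"
  have iL: "q - c \<in> interior ?L" using q by (simp add: interior_translation_subtract)
  then have "- (q - c) \<in> ?L" using neg interior_subset by blast
  then have "- (q - c) - (1/2) *\<^sub>R (- (q - c) - (q - c)) \<in> interior ?L"
    by (intro mem_interior_convex_shrink[OF cL iL]) auto
  moreover have "(1/2) *\<^sub>R (- (q - c) - (q - c)) = - (q - c)"
    using scaleR_half_double[of "- (q - c)"] by (simp only: diff_conv_add_uminus)
  ultimately show "0 \<in> interior ?L" by simp
qed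

lemma center_of_translate:
  assumes K: "convex_body K" and c: "center_of_symmetry c K"
  shows "center_of_symmetry d ((+) v ` K) \<longleftrightarrow> d = v + c"
proof -
  have sym: "center_of_symmetry (v + c) ((+) v ` K)"
  proof -
    have "(\<lambda>x. 2 *\<^sub>R (v + c) - x) ` (+) v ` K = (+) v ` (\<lambda>x. 2 *\<^sub>R c - x) ` K"
      by (simp add: image_image algebra_simps scaleR_2)
    then show ?thesis using c by (simp add: center_of_symmetry_def)
  qed
  have "bounded ((+) v ` K)" "(+) v ` K \<noteq> {}"
    using K by (auto simp: convex_body_def compact_imp_bounded intro!: bounded_translation)
  then show ?thesis using sym center_of_symmetry_unique by blast
qed

text \<open>By symmetry and convexity, \<open>v + L\<close> and \<open>w + L\<close> meet exactly when the midpoint of their centers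
belongs to both, that is when \<open>(v - w) / 2\<close> lies in \<open>L\<close>.\<close>

lemma translate_arrangement_iff_spread:
  assumes K: "convex_body K" and c: "center_of_symmetry c K"
  shows "inj (\<lambda>v. (+) v ` K)"
    and "pairwise_intersecting_Minkowski_arrangement K ((\<lambda>v. (+) v ` K) ` V)
      \<longleftrightarrow> spread ((\<lambda>x. x - c) ` K) V"
proof -
  let ?L = "(\<lambda>x. x - c) ` K"
  interpret symmetric_body ?L using centered_symmetric_body[OF K c] .
  show inj: "inj (\<lambda>v. (+) v ` K)"
  proof (rule injI)
    fix v w assume "(+) v ` K = (+) w ` K"
    then have "v + c = w + c" using center_of_translate[OF K c] by metis
    then show "v = w" by simp
  qed
  have KL: "x \<in> K \<longleftrightarrow> x - c \<in> ?L" for x by auto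
  have meet: "(+) v ` K \<inter> (+) w ` K \<noteq> {} \<longleftrightarrow> (1/2) *\<^sub>R (v - w) \<in> ?L" for v w
  proof
    assume "(+) v ` K \<inter> (+) w ` K \<noteq> {}"
    then obtain p q where pq: "p \<in> K" "q \<in> K" "v + p = w + q" by auto
    have "(1/2) *\<^sub>R (q - c) + (1/2) *\<^sub>R (- (p - c)) \<in> ?L"
      using pq minus_L[of "p - c"] by (intro convexD[OF convex_L]) auto
    also have "(1/2) *\<^sub>R (q - c) + (1/2) *\<^sub>R (- (p - c)) = (1/2) *\<^sub>R (q - p)" by (simp add: algebra_simps)
    also have "q - p = v - w" using pq(3) by (simp add: algebra_simps)
    finally show "(1/2) *\<^sub>R (v - w) \<in> ?L" .
  next
    assume half: "(1/2) *\<^sub>R (v - w) \<in> ?L"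
    define h where "h = (1/2) *\<^sub>R (v - w)"
    have h: "h \<in> ?L" using half by (simp add: h_def)
    have "h + h = v - w" by (simp add: h_def flip: scaleR_left_distrib)
    then have v: "v = w + (h + h)" by simp
    have "c + h \<in> K" "c - h \<in> K"
      using h minus_L[OF h] KL[of "c + h"] KL[of "c - h"] by simp_all
    moreover have "v + (c - h) = w + (c + h)" by (simp add: v)
    ultimately show "(+) v ` K \<inter> (+) w ` K \<noteq> {}" by (metis IntI emptyE imageI)
  qed
  have inside: "v + c \<in> interior ((+) w ` K) \<longleftrightarrow> v - w \<in> interior ?L" for v w
  proof -
    have "v + c \<in> (+) w ` interior K \<longleftrightarrow> v - w + c \<in> interior K"
      by (auto simp: algebra_simps intro!: image_eqI[of _ _ "v - w + c"])
    moreover have "v - w \<in> (\<lambda>x. x - c) ` interior K \<longleftrightarrow> v - w + c \<in> interior K"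
      by (auto intro!: image_eqI[of _ _ "v - w + c"])
    ultimately show ?thesis by (simp add: interior_translation interior_translation_subtract)
  qed
  have hom: "positive_homothetic_copy K ((+) v ` K)" for v
    unfolding positive_homothetic_copy_def by (intro exI[of _ 1] exI[of _ v] conjI) auto
  have neq: "(+) v ` K \<noteq> (+) w ` K \<longleftrightarrow> v \<noteq> w" for v w using inj by (auto dest: injD)
  show "pairwise_intersecting_Minkowski_arrangement K ((\<lambda>v. (+) v ` K) ` V) \<longleftrightarrow> spread ?L V"
    unfolding pairwise_intersecting_Minkowski_arrangement_def spread_def pairwise_def
    using hom by (simp add: neq meet inside center_of_translate[OF K c]) blast
qed

lemma family_of_translates:
  assumes "\<forall>A\<in>F. translate_of K A"
  shows "F = (\<lambda>v. (+) v ` K) ` {v. (+) v ` K \<in> F}"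
proof (intro equalityI subsetI)
  fix A assume A: "A \<in> F"
  then obtain v where "A = (+) v ` K" using assms unfolding translate_of_def by blast
  then show "A \<in> (\<lambda>v. (+) v ` K) ` {v. (+) v ` K \<in> F}" using A by blast
qed blast

lemma parallelotope_center_coordinates:
  assumes K: "convex_body K" and c: "center_of_symmetry c K"
    and par: "parallelotope n K"
  obtains B where "independent B" "card B = n"
    "(\<lambda>x. x - c) ` K = {\<Sum>b\<in>B. s b *\<^sub>R b | s. \<forall>b\<in>B. \<bar>s b\<bar> \<le> 1/2}"
proof -
  obtain a B where B: "independent B" "card B = n"
    and Keq: "K = {a + (\<Sum>b\<in>B. t b *\<^sub>R b) | t. \<forall>b\<in>B. 0 \<le> t b \<and> t b \<le> 1}"
    using par unfolding parallelotope_def by blast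
  define m where "m = a + (\<Sum>b\<in>B. (1/2) *\<^sub>R b)"
  have Km: "x \<in> K \<longleftrightarrow> (\<exists>s. x = m + (\<Sum>b\<in>B. s b *\<^sub>R b) \<and> (\<forall>b\<in>B. \<bar>s b\<bar> \<le> 1/2))" for x
  proof
    assume "x \<in> K"
    then obtain t where t: "x = a + (\<Sum>b\<in>B. t b *\<^sub>R b)" "\<forall>b\<in>B. 0 \<le> t b \<and> t b \<le> 1"
      using Keq by auto
    have "x = m + (\<Sum>b\<in>B. (t b - 1/2) *\<^sub>R b)"
      by (simp add: t(1) m_def scaleR_left_diff_distrib sum_subtractf)
    moreover have "\<forall>b\<in>B. \<bar>t b - 1/2\<bar> \<le> 1/2"
    proof
      fix b assume "b \<in> B"
      then have "0 \<le> t b" "t b \<le> 1" using t(2) by auto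
      then show "\<bar>t b - 1/2\<bar> \<le> 1/2" by linarith
    qed
    ultimately show "\<exists>s. x = m + (\<Sum>b\<in>B. s b *\<^sub>R b) \<and> (\<forall>b\<in>B. \<bar>s b\<bar> \<le> 1/2)"
      by (intro exI[of _ "\<lambda>b. t b - 1/2"] conjI)
  next
    assume "\<exists>s. x = m + (\<Sum>b\<in>B. s b *\<^sub>R b) \<and> (\<forall>b\<in>B. \<bar>s b\<bar> \<le> 1/2)"
    then obtain s where s: "x = m + (\<Sum>b\<in>B. s b *\<^sub>R b)" "\<forall>b\<in>B. \<bar>s b\<bar> \<le> 1/2" by blast
    have "x = a + (\<Sum>b\<in>B. (1/2 + s b) *\<^sub>R b)"
      by (simp add: s(1) m_def scaleR_left_distrib sum.distrib)
    moreover have "\<forall>b\<in>B. 0 \<le> 1/2 + s b \<and> 1/2 + s b \<le> 1" using s(2) by (auto simp: abs_le_iff)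
    ultimately show "x \<in> K" unfolding Keq mem_Collect_eq
      by (intro exI[of _ "\<lambda>b. 1/2 + s b"] conjI)
  qed
  have refl: "2 *\<^sub>R m - x \<in> K" if xK: "x \<in> K" for x
  proof -
    obtain s where s: "x = m + (\<Sum>b\<in>B. s b *\<^sub>R b)" "\<forall>b\<in>B. \<bar>s b\<bar> \<le> 1/2" using Km[of x] xK by blast
    then have "2 *\<^sub>R m - x = m + (\<Sum>b\<in>B. (- s b) *\<^sub>R b)" by (simp add: scaleR_2 sum_negf)
    then show ?thesis unfolding Km using s(2) by (intro exI[of _ "\<lambda>b. - s b"]) auto
  qed
  have "center_of_symmetry m K" unfolding center_of_symmetry_def
  proof (intro equalityI subsetI)
    show "x \<in> (\<lambda>x. 2 *\<^sub>R m - x) ` K" if "x \<in> K" for x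
      using refl[OF that] by (intro image_eqI[of _ _ "2 *\<^sub>R m - x"]) auto
  qed (use refl in auto)
  moreover have "bounded K" "K \<noteq> {}" using K by (auto simp: convex_body_def compact_imp_bounded)
  ultimately have "c = m" using c center_of_symmetry_unique by blast
  then have "(\<lambda>x. x - c) ` K = {\<Sum>b\<in>B. s b *\<^sub>R b | s. \<forall>b\<in>B. \<bar>s b\<bar> \<le> 1/2}"
  proof (intro equalityI subsetI)
    fix z assume "z \<in> (\<lambda>x. x - c) ` K"
    then obtain x where "x \<in> K" "z = x - m" using \<open>c = m\<close> by blast
    then show "z \<in> {\<Sum>b\<in>B. s b *\<^sub>R b | s. \<forall>b\<in>B. \<bar>s b\<bar> \<le> 1/2}" using Km[of x] by auto
  next
    fix z assume "z \<in> {\<Sum>b\<in>B. s b *\<^sub>R b | s. \<forall>b\<in>B. \<bar>s b\<bar> \<le> 1/2}"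
    then have "m + z \<in> K" unfolding Km by blast
    then show "z \<in> (\<lambda>x. x - c) ` K" using \<open>c = m\<close> by force
  qed
  with B show ?thesis by (rule that)
qed

theorem theorem1:
  fixes K :: "'a::euclidean_space set"
  assumes "convex_body K" and "centrally_symmetric K"
  shows "(\<forall>F. pairwise_intersecting_Minkowski_arrangement K F \<and> (\<forall>A\<in>F. translate_of K A)
            \<longrightarrow> finite F \<and> card F \<le> 3 ^ DIM('a))
       \<and> ((\<exists>F. pairwise_intersecting_Minkowski_arrangement K F \<and> (\<forall>A\<in>F. translate_of K A)
            \<and> finite F \<and> card F = 3 ^ DIM('a))
          \<longleftrightarrow> parallelotope DIM('a) K)"
proof -
  obtain c where c: "center_of_symmetry c K" using assms(2) by (auto simp: centrally_symmetric_def)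
  let ?L = "(\<lambda>x. x - c) ` K"
  let ?T = "\<lambda>v. (+) v ` K"
  interpret symmetric_body ?L using centered_symmetric_body[OF assms(1) c] .
  note iff = translate_arrangement_iff_spread[OF assms(1) c]
  have vectors: "\<exists>V. spread ?L V \<and> F = ?T ` V \<and> card F = card V"
    if mink: "pairwise_intersecting_Minkowski_arrangement K F" and tr: "\<forall>A\<in>F. translate_of K A" for F
  proof -
    obtain V where F: "F = ?T ` V" using family_of_translates[OF tr] by blast
    then have "spread ?L V" using mink iff(2)[of V] by blast
    moreover have "card F = card V"
      unfolding F using card_image[OF inj_on_subset[OF iff(1) subset_UNIV]] .
    ultimately show ?thesis using F by blast
  qed
  have bound: "finite F \<and> card F \<le> 3 ^ DIM('a)"
    if F: "pairwise_intersecting_Minkowski_arrangement K F" "\<forall>A\<in>F. translate_of K A" for F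
  proof -
    obtain V where "spread ?L V" "F = ?T ` V" "card F = card V" using vectors[OF F] by blast
    then show ?thesis using spread_card[of V] by simp
  qed
  have extremal: "parallelotope DIM('a) K"
    if F: "pairwise_intersecting_Minkowski_arrangement K F" "\<forall>A\<in>F. translate_of K A"
      "card F = 3 ^ DIM('a)" for F
  proof -
    obtain V where V: "spread ?L V" "card V = 3 ^ DIM('a)" using vectors[OF F(1,2)] unfolding F(3) by auto
    obtain Y N where Y: "finite Y" "independent Y" "card Y = DIM('a)"
      and Naa: "\<And>a. a \<in> Y \<Longrightarrow> N a \<bullet> a = (1::real)"
      and Nab: "\<And>a b. a \<in> Y \<Longrightarrow> b \<in> Y \<Longrightarrow> a \<noteq> b \<Longrightarrow> N a \<bullet> b = 0"
      and rep: "\<And>y. y = (\<Sum>a\<in>Y. (N a \<bullet> y) *\<^sub>R a)"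
      and boxL: "\<And>y. y \<in> ?L \<longleftrightarrow> (\<forall>a\<in>Y. \<bar>N a \<bullet> y\<bar> \<le> 1/2)"
      by (rule extremal_spread_set_box[OF V]) (rule that; assumption)
    define m where "m = c - (\<Sum>a\<in>Y. (1/2) *\<^sub>R a)"
    have "K = {m + (\<Sum>a\<in>Y. t a *\<^sub>R a) | t. \<forall>a\<in>Y. 0 \<le> t a \<and> t a \<le> 1}"
    proof (intro equalityI subsetI)
      fix x assume "x \<in> K"
      then have "\<forall>a\<in>Y. \<bar>N a \<bullet> (x - c)\<bar> \<le> 1/2" using boxL by blast
      then have "\<forall>a\<in>Y. 0 \<le> 1/2 + N a \<bullet> (x - c) \<and> 1/2 + N a \<bullet> (x - c) \<le> 1"
        by (auto simp: abs_le_iff)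
      moreover have "x = m + (\<Sum>a\<in>Y. (1/2 + N a \<bullet> (x - c)) *\<^sub>R a)"
      proof -
        have "(\<Sum>a\<in>Y. (1/2 + N a \<bullet> (x - c)) *\<^sub>R a)
            = (\<Sum>a\<in>Y. (1/2) *\<^sub>R a) + (\<Sum>a\<in>Y. (N a \<bullet> (x - c)) *\<^sub>R a)"
          by (simp only: scaleR_left_distrib sum.distrib)
        also have "(\<Sum>a\<in>Y. (N a \<bullet> (x - c)) *\<^sub>R a) = x - c" by (rule rep[symmetric])
        finally show ?thesis by (simp add: m_def)
      qed
      ultimately show "x \<in> {m + (\<Sum>a\<in>Y. t a *\<^sub>R a) | t. \<forall>a\<in>Y. 0 \<le> t a \<and> t a \<le> 1}"
        unfolding mem_Collect_eq by (intro exI[of _ "\<lambda>a. 1/2 + N a \<bullet> (x - c)"] conjI)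
    next
      fix x assume "x \<in> {m + (\<Sum>a\<in>Y. t a *\<^sub>R a) | t. \<forall>a\<in>Y. 0 \<le> t a \<and> t a \<le> 1}"
      then obtain t where t: "x = m + (\<Sum>a\<in>Y. t a *\<^sub>R a)" "\<forall>a\<in>Y. 0 \<le> t a \<and> t a \<le> 1" by auto
      have xc: "x - c = (\<Sum>a\<in>Y. (t a - 1/2) *\<^sub>R a)"
        by (simp add: t(1) m_def scaleR_left_diff_distrib sum_subtractf)
      have "N b \<bullet> (x - c) = t b - 1/2" if "b \<in> Y" for b
      proof -
        have "(\<Sum>a\<in>Y. (N a \<bullet> (x - c)) *\<^sub>R a) = (\<Sum>a\<in>Y. (t a - 1/2) *\<^sub>R a)"
          by (rule trans[OF rep[symmetric] xc])
        from independent_coefficients_unique[OF Y(2) this that] show ?thesis .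
      qed
      moreover have "\<bar>t b - 1/2\<bar> \<le> 1/2" if "b \<in> Y" for b
      proof -
        have "0 \<le> t b" "t b \<le> 1" using t(2) that by auto
        then show ?thesis by linarith
      qed
      ultimately have "x - c \<in> ?L" unfolding boxL by simp
      then show "x \<in> K" by auto
    qed
    then show ?thesis unfolding parallelotope_def using Y(2,3) by (intro exI conjI)
  qed
  have construction: "\<exists>F. pairwise_intersecting_Minkowski_arrangement K F \<and> (\<forall>A\<in>F. translate_of K A)
            \<and> finite F \<and> card F = 3 ^ DIM('a)" if par: "parallelotope DIM('a) K"
  proof -
    obtain B where B: "independent B" "card B = DIM('a)"
      "?L = {\<Sum>b\<in>B. s b *\<^sub>R b | s. \<forall>b\<in>B. \<bar>s b\<bar> \<le> 1/2}"
      by (rule parallelotope_center_coordinates[OF assms(1) c par])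
    obtain V where V: "spread ?L V" "finite V" "card V = 3 ^ card B"
      by (rule box_has_extremal_spread_set[OF B(1,3)])
    have "card (?T ` V) = card V" using card_image[OF inj_on_subset[OF iff(1) subset_UNIV]] .
    then have "card (?T ` V) = 3 ^ DIM('a)" using V(3) B(2) by simp
    moreover have "\<forall>A\<in>?T ` V. translate_of K A" unfolding translate_of_def by blast
    moreover have "finite (?T ` V)" using V(2) by simp
    moreover have "pairwise_intersecting_Minkowski_arrangement K (?T ` V)" using iff(2) V(1) by blast
    ultimately show ?thesis by (intro exI[of _ "?T ` V"] conjI)
  qed
  show ?thesis
  proof (intro conjI iffI allI impI)
    fix F assume "pairwise_intersecting_Minkowski_arrangement K F \<and> (\<forall>A\<in>F. translate_of K A)"
    then show "finite F" "card F \<le> 3 ^ DIM('a)" using bound[of F] by simp_all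
  next
    assume "\<exists>F. pairwise_intersecting_Minkowski_arrangement K F \<and> (\<forall>A\<in>F. translate_of K A)
            \<and> finite F \<and> card F = 3 ^ DIM('a)"
    then show "parallelotope DIM('a) K" by (elim exE conjE) (rule extremal)
  qed (rule construction)
qed

end
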